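(* Let $d>2$ be an integer, $c_0\in(0,1]$, $\varepsilon\in(0,1)$. Let $\mathbf{c},\mathbf{C}>0$ and $\boldsymbol{\delta}\in(0,\tfrac12]$ be constants with the following property: for every admissible kernel $J$ with constant $c_0$ and every $G\in\mathcal G$ such that $J$ and $G$ obey Assumption 1, one has $G_\beta(x)\le \delta_0(x)+\frac{\mathbf{C}}{\sigma_J^d}\big(\frac{\sigma_J}{\sigma_J\vee|x|}\big)^{d-2-\varepsilon}\exp(-\mathbf{c}|x|/\xi(\beta))$ for all $x\in\mathbb Z^d$ and $\beta\in[0,\beta(\boldsymbol\delta)]$. Suppose that $J$ (admissible with constant $c_0$) and $G\in\mathcal G$ obey Assumption 1 and that $E(\beta(\boldsymbol{\delta}))<\boldsymbol{\delta}$ (Assumption 2). Suppose further that $\chi(\beta_c)=\infty$. Then, with $E=E(\beta_c)$ (which is less than $\boldsymbol\delta$), for every $\beta<\beta_c$, $$1\le\beta_c\le\frac{1}{1-E},$$ $$\frac{1}{\beta_c-\beta}\le\chi(\beta)\le\frac{1}{1-E}\,\frac{1}{\beta_c-\beta},$$ $$\left(\frac{1}{\beta_c-\beta}\right)^{1-2E}\le\frac{\xi(\beta)^2}{\sigma_J^2}\le\left(\frac{1}{(1-E)(\beta_c-\beta)}\right)^{\frac{1+E}{1-E}}.$$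
   Context: Notation: $|x|_2$ is the Euclidean norm and $|x|=\max_i|x_i|$; $a\vee b=\max(a,b)$; $\delta_0$ is the Kronecker delta at $0\in\mathbb Z^d$; $(f*g)(x)=\sum_{y\in\mathbb Z^d}f(y)g(x-y)$; $\|f\|_1=\sum_x f(x)$ and $\||x|_2^2\cdot f\|_1=\sum_x|x|_2^2f(x)$ for $f\ge0$. A function on $\mathbb Z^d$ is $\mathbb Z^d$-symmetric if it is invariant under permutations of coordinates and sign changes of coordinates. Admissible kernel with constant $c_0\in(0,1]$: a function $J:\mathbb Z^d\to[0,\infty)$ with $J_0=0$, $\sum_xJ_x=1$, $\mathbb Z^d$-symmetric, with finite range $R_J=\max\{|x|:J_x>0\}\in[1,\infty)$, and, with $\sigma_J^2=\sum_x|x|_2^2J_x$, satisfying $c_0R_J\le\sigma_J$ and $J_x\le c_0^{-1}R_J^{-d}$ for all $x$. Class $\mathcal G$: families of functions $G_\beta:\mathbb Z^d\to[0,\infty]$ indexed by $\beta\in[0,\beta_c]$, for some $\beta_c\in[0,\infty]$, such that: (i) $G_0=\delta_0$; (ii) for every $x$, $\beta\mapsto G_\beta(x)$ is non-decreasing and differentiable on $[0,\beta_c)$; (iii) each $G_\beta$ is $\mathbb Z^d$-symmetric; (iv) for each $\beta\in[0,\beta_c)$, $G_\beta(x)$ decays exponentially in $x$; (v) if $\beta_c<\infty$, $\lim_{\beta\uparrow\beta_c}G_\beta(x)=G_{\beta_c}(x)$ for every $x$ (possibly infinite). Assumption 1 (on an admissible kernel $J$ and $G\in\mathcal G$): (i)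 for all $0\le\beta'\le\beta<\beta_c$, $G_\beta\le G_{\beta'}+(\beta-\beta')(G_{\beta'}*J*G_\beta)$ pointwise; (ii) for every $\beta<\beta_c$ there is $H_\beta:\mathbb Z^d\to[0,\infty)$ (which may depend on $J,G$) with $\partial_\beta G_\beta\ge G_\beta*(J-H_\beta)*G_\beta$ pointwise, where, for all $x$, $H_0(x)=0$, $H_\beta(x)=H_\beta(-x)$, $\beta\mapsto H_\beta(x)$ is continuous on $[0,\beta_c)$, and $H_\beta(x)$ decays exponentially in $x$ for each fixed $\beta$. Set $F_\beta=J*G_\beta$, $\chi(\beta)=\|G_\beta\|_1=\|F_\beta\|_1$ (also at $\beta=\beta_c$, possibly infinite), and for $\beta<\beta_c$, $\xi(\beta)^2=\||x|_2^2\cdot F_\beta\|_1/\chi(\beta)$, $E(\beta)=\sup_{0\le t\le\beta}\left(\|H_t\|_1+\||x|_2^2\cdot H_t\|_1/\xi(t)^2\right)$; also $E(\beta_c)$ denotes the same supremum over $0\le t<\beta_c$. For $\delta>0$, $\beta(\delta)=\sup\{\beta\in[0,\beta_c):E(\beta)<\delta\}$. If $\beta(\boldsymbol\delta)=\beta_c$, then $\xi(\beta_c)=\lim_{\beta\uparrow\beta_c}\xi(\beta)\in(0,\infty]$, with the exponential factor equal to $1$ if $\xi(\beta_c)=\infty$.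
   Formalization: The parenthetical claim E(β_c)<δ is assumed rather than derived from Assumption 2: with H_β only pointwise continuous in β, E may jump just after β(δ), so that E(β(δ))<δ holds while E(β_c)>1 and the stated bounds fail. *)

theory Defs
  imports "HOL-Analysis.Analysis"
begin

(* The lattice of dimension d is the type (int, 'd) vec with d = CARD('d).  The parameter beta
   ranges over [0, infinity], i.e. over ennreal.  A family G is a total function of which only the
   members with beta <= beta_c matter; likewise H and beta < beta_c. *)

definition sup_abs :: "int ^ 'd \<Rightarrow> real" where
  "sup_abs x = real_of_int (Max (range (\<lambda>i. \<bar>x $ i\<bar>)))"

definition eucl_sq :: "int ^ 'd \<Rightarrow> real" where
  "eucl_sq x = (\<Sum>i\<in>UNIV. (real_of_int (x $ i))\<^sup>2)"

definition delta0 :: "int ^ 'd \<Rightarrow> real" where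
  "delta0 x = (if x = 0 then 1 else 0)"

definition lattice_symmetric :: "(int ^ 'd \<Rightarrow> 'b) \<Rightarrow> bool" where
  "lattice_symmetric f \<longleftrightarrow>
     (\<forall>p x. p permutes UNIV \<longrightarrow> f (\<chi> i. x $ p i) = f x) \<and>
     (\<forall>s x. (\<forall>i. s i \<in> {1, -1}) \<longrightarrow> f (\<chi> i. s i * x $ i) = f x)"

(* Used at type ennreal, where the sum always exists, and at type real (signed kernels), where it is
   only applied to exponentially decaying functions. *)
definition conv :: "(int ^ 'd \<Rightarrow> 'b) \<Rightarrow> (int ^ 'd \<Rightarrow> 'b) \<Rightarrow> int ^ 'd \<Rightarrow> 'b::{comm_monoid_add,times,t2_space}" where
  "conv f g x = (\<Sum>\<^sub>\<infinity>y\<in>UNIV. f y * g (x - y))"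

definition exp_decay :: "(int ^ 'd \<Rightarrow> ennreal) \<Rightarrow> bool" where
  "exp_decay f \<longleftrightarrow> (\<exists>K>0. \<exists>a>0. \<forall>x. f x \<le> ennreal (K * exp (- a * sup_abs x)))"

definition l1 :: "(int ^ 'd \<Rightarrow> ennreal) \<Rightarrow> ennreal" where
  "l1 f = (\<Sum>\<^sub>\<infinity>x\<in>UNIV. f x)"

definition second_moment :: "(int ^ 'd \<Rightarrow> ennreal) \<Rightarrow> ennreal" where
  "second_moment f = l1 (\<lambda>x. ennreal (eucl_sq x) * f x)"

definition kernel_range :: "(int ^ 'd \<Rightarrow> real) \<Rightarrow> real" where
  "kernel_range J = Max (sup_abs ` {x. J x > 0})"

definition sigma_of :: "(int ^ 'd \<Rightarrow> real) \<Rightarrow> real" where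
  "sigma_of J = sqrt (\<Sum>\<^sub>\<infinity>x\<in>UNIV. eucl_sq x * J x)"

definition admissible :: "real \<Rightarrow> (int ^ 'd \<Rightarrow> real) \<Rightarrow> bool" where
  "admissible c0 J \<longleftrightarrow>
     (\<forall>x. 0 \<le> J x) \<and> J 0 = 0 \<and> (J has_sum 1) UNIV \<and> lattice_symmetric J \<and>
     finite {x. J x > 0} \<and> 1 \<le> kernel_range J \<and>
     c0 * kernel_range J \<le> sigma_of J \<and>
     (\<forall>x. J x \<le> inverse c0 * inverse (kernel_range J ^ CARD('d)))"

definition subcritical :: "ennreal \<Rightarrow> real set" where
  "subcritical \<beta>c = {t. 0 \<le> t \<and> ennreal t < \<beta>c}"

(* By the decay condition every G beta with beta < beta_c is finite, so enn2real loses nothing.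
   Derivatives at beta = 0 are one-sided. *)
definition class_G :: "ennreal \<Rightarrow> (ennreal \<Rightarrow> int ^ 'd \<Rightarrow> ennreal) \<Rightarrow> bool" where
  "class_G \<beta>c G \<longleftrightarrow>
     (\<forall>x. G 0 x = ennreal (delta0 x)) \<and>
     (\<forall>x. mono_on {..<\<beta>c} (\<lambda>\<beta>. G \<beta> x) \<and>
          (\<lambda>t. enn2real (G (ennreal t) x)) differentiable_on subcritical \<beta>c) \<and>
     (\<forall>\<beta>\<le>\<beta>c. lattice_symmetric (G \<beta>)) \<and>
     (\<forall>\<beta><\<beta>c. exp_decay (G \<beta>)) \<and>
     (\<beta>c < \<infinity> \<longrightarrow> (\<forall>x. ((\<lambda>\<beta>. G \<beta> x) \<longlongrightarrow> G \<beta>c x) (at_left \<beta>c)))"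

(* The function H whose existence is postulated is a parameter, since err_E and beta_of below
   depend on it. *)
definition assumption1 ::
  "(int ^ 'd \<Rightarrow> real) \<Rightarrow> ennreal \<Rightarrow> (ennreal \<Rightarrow> int ^ 'd \<Rightarrow> ennreal) \<Rightarrow> (ennreal \<Rightarrow> int ^ 'd \<Rightarrow> real) \<Rightarrow> bool" where
  "assumption1 J \<beta>c G H \<longleftrightarrow>
     (\<forall>\<beta>' \<beta> x. \<beta>' \<le> \<beta> \<and> \<beta> < \<beta>c \<longrightarrow>
        G \<beta> x \<le> G \<beta>' x + (\<beta> - \<beta>') * conv (conv (G \<beta>') (\<lambda>y. ennreal (J y))) (G \<beta>) x) \<and>
     (\<forall>t\<in>subcritical \<beta>c. \<forall>x. \<exists>D.
        ((\<lambda>s. enn2real (G (ennreal s) x)) has_real_derivative D) (at t within subcritical \<beta>c) \<and>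
        D \<ge> conv (conv (\<lambda>y. enn2real (G (ennreal t) y)) (\<lambda>y. J y - H (ennreal t) y))
                 (\<lambda>y. enn2real (G (ennreal t) y)) x) \<and>
     (\<forall>\<beta><\<beta>c. \<forall>x. 0 \<le> H \<beta> x) \<and>
     (\<forall>x. H 0 x = 0) \<and>
     (\<forall>\<beta><\<beta>c. \<forall>x. H \<beta> (- x) = H \<beta> x) \<and>
     (\<forall>x. continuous_on {..<\<beta>c} (\<lambda>\<beta>. H \<beta> x)) \<and>
     (\<forall>\<beta><\<beta>c. exp_decay (\<lambda>x. ennreal (H \<beta> x)))"

definition J_conv_G :: "(int ^ 'd \<Rightarrow> real) \<Rightarrow> (ennreal \<Rightarrow> int ^ 'd \<Rightarrow> ennreal) \<Rightarrow> ennreal \<Rightarrow> int ^ 'd \<Rightarrow> ennreal" where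
  "J_conv_G J G \<beta> = conv (\<lambda>y. ennreal (J y)) (G \<beta>)"

(* Equals l1 (J_conv_G J G \<beta>), because J sums to 1. *)
definition susc :: "(ennreal \<Rightarrow> int ^ 'd \<Rightarrow> ennreal) \<Rightarrow> ennreal \<Rightarrow> ennreal" where
  "susc G \<beta> = l1 (G \<beta>)"

definition xi_sq :: "(int ^ 'd \<Rightarrow> real) \<Rightarrow> (ennreal \<Rightarrow> int ^ 'd \<Rightarrow> ennreal) \<Rightarrow> ennreal \<Rightarrow> ennreal" where
  "xi_sq J G \<beta> = second_moment (J_conv_G J G \<beta>) / susc G \<beta>"

(* xi at beta_c is a limit, possibly infinite; below beta_c, xi_sq is finite and positive. *)
definition xi :: "(int ^ 'd \<Rightarrow> real) \<Rightarrow> ennreal \<Rightarrow> (ennreal \<Rightarrow> int ^ 'd \<Rightarrow> ennreal) \<Rightarrow> ennreal \<Rightarrow> ennreal" where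
  "xi J \<beta>c G \<beta> =
     (let r = (\<lambda>b. ennreal (sqrt (enn2real (xi_sq J G b))))
      in if \<beta> < \<beta>c then r \<beta> else Lim (at_left \<beta>c) r)"

(* For \<beta> = \<beta>c the supremum is over t < \<beta>c.  As H \<beta> x is continuous in \<beta> only for each fixed x,
   err_E need not be right-continuous at beta_of \<delta>; hence its value there being less than \<delta> does not by
   itself entail beta_of \<delta> = \<beta>c, nor that err_E at \<beta>c is less than \<delta>. *)
definition err_E ::
  "(int ^ 'd \<Rightarrow> real) \<Rightarrow> ennreal \<Rightarrow> (ennreal \<Rightarrow> int ^ 'd \<Rightarrow> ennreal) \<Rightarrow> (ennreal \<Rightarrow> int ^ 'd \<Rightarrow> real) \<Rightarrow> ennreal \<Rightarrow> ennreal" where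
  "err_E J \<beta>c G H \<beta> =
     (SUP t \<in> {t. t \<le> \<beta> \<and> t < \<beta>c}.
        l1 (\<lambda>x. ennreal (H t x)) + second_moment (\<lambda>x. ennreal (H t x)) / xi_sq J G t)"

definition beta_of ::
  "(int ^ 'd \<Rightarrow> real) \<Rightarrow> ennreal \<Rightarrow> (ennreal \<Rightarrow> int ^ 'd \<Rightarrow> ennreal) \<Rightarrow> (ennreal \<Rightarrow> int ^ 'd \<Rightarrow> real) \<Rightarrow> real \<Rightarrow> ennreal" where
  "beta_of J \<beta>c G H \<delta> = Sup {\<beta>. \<beta> < \<beta>c \<and> err_E J \<beta>c G H \<beta> < ennreal \<delta>}"

definition exp_factor :: "real \<Rightarrow> int ^ 'd \<Rightarrow> ennreal \<Rightarrow> real" where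
  "exp_factor c x \<rho> = (if \<rho> = \<infinity> then 1 else exp (- c * sup_abs x / enn2real \<rho>))"

definition decay_bound ::
  "real \<Rightarrow> real \<Rightarrow> real \<Rightarrow> real \<Rightarrow>
   (int ^ 'd \<Rightarrow> real) \<Rightarrow> ennreal \<Rightarrow> (ennreal \<Rightarrow> int ^ 'd \<Rightarrow> ennreal) \<Rightarrow> (ennreal \<Rightarrow> int ^ 'd \<Rightarrow> real) \<Rightarrow> bool" where
  "decay_bound \<epsilon> c C \<delta> J \<beta>c G H \<longleftrightarrow>
     (\<forall>x. \<forall>\<beta>\<le>beta_of J \<beta>c G H \<delta>.
        G \<beta> x \<le> ennreal (delta0 x +
          C / sigma_of J ^ CARD('d) *
          (sigma_of J / max (sigma_of J) (sup_abs x)) powr (real CARD('d) - 2 - \<epsilon>) *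
          exp_factor c x (xi J \<beta>c G \<beta>)))"

end

theory Submission
  imports Defs
begin

text \<open>
  Put \<open>chi(t) = \<Sum>x. G\<^sub>t(x)\<close> and let \<open>M(t)\<close> be the second moment of \<open>J * G\<^sub>t\<close>, so that the
  squared correlation length is \<open>M / chi\<close>. Summing the two inequalities of the assumption over the
  lattice, with weight 1 and with a quadratic weight, gives

    \<open>(1 - e) chi\<^sup>2 \<le> chi' \<le> chi\<^sup>2\<close>   and   \<open>2 (1 - e) M chi \<le> M' \<le> 2 M chi\<close>.

  Masses are multiplicative under convolution, and for even functions the second moment satisfies the
  product rule \<open>moment2 (f * g) = moment2 f * mass g + mass f * moment2 g\<close>; this
  (\<open>moment_kernel_conv\<close>) accounts for both upper bounds and for the factors of the lower bounds,
  while \<open>e\<close> controls the contribution of \<open>H\<close> (\<open>error_bound\<close>, \<open>M_lower\<close>).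

  The rest is one-dimensional analysis. From the first pair, \<open>1 / chi\<close> decreases with slope between
  \<open>1 - e\<close> and \<open>1\<close>. As it starts at 1 and stays positive, \<open>\<beta>c \<le> 1 / (1 - e)\<close>; so \<open>\<beta>c\<close> is
  finite and the divergence of the susceptibility at \<open>\<beta>c\<close> means that \<open>1 / chi\<close> decreases to 0.
  This gives the bounds on \<open>chi\<close> and \<open>1 \<le> \<beta>c\<close>. Both pairs together give
  \<open>(1 - 2 e) chi \<le> (ln (M / chi))' \<le> (1 + e) chi\<close>, and integration of the bounds on \<open>chi\<close> yields
  the powers of \<open>\<beta>c - \<beta>\<close> (\<open>ratio_bounds\<close>).

  The derivatives above need not exist, since only the individual \<open>G\<^sub>t(x)\<close> are differentiable.
  The upper bounds are used in integrated form, as the assumption supplies them. For the lower bounds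
  it is enough to work with lower right Dini derivatives (\<open>right_growth\<close>): each \<open>G\<^sub>t(x)\<close> is
  nondecreasing in \<open>t\<close>, so the increment of the whole sum is at least the increment of any finite part
  (\<open>right_growth_infsum\<close>), and continuous functions with nonnegative such derivative are monotone
  (\<open>right_growth_nonneg_imp_le\<close>).
\<close>

section \<open>Infinite sums\<close>

lemma has_sum_product_real:
  fixes f :: "'a \<Rightarrow> real" and g :: "'b \<Rightarrow> real"
  assumes f: "f summable_on A" and g: "g summable_on B"
  shows "((\<lambda>(x, y). f x * g y) has_sum infsum f A * infsum g B) (A \<times> B)"
proof -
  have "(\<lambda>x. norm (f x)) summable_on A" "(\<lambda>x. norm (g x)) summable_on B"
    using f g summable_on_iff_abs_summable_on_real by blast+
  then have "(\<lambda>p. norm (case p of (x, y) \<Rightarrow> f x * g y)) summable_on A \<times> B"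
    unfolding Infinite_Sum.abs_summable_on_Sigma_iff
    by (auto simp: abs_mult infsum_cmult_right' abs_of_nonneg infsum_nonneg
        intro!: summable_on_cmult_right summable_on_cmult_left)
  then have *: "(\<lambda>(x, y). f x * g y) summable_on A \<times> B"
    using summable_on_iff_abs_summable_on_real by blast
  have "(\<Sum>\<^sub>\<infinity>(x, y)\<in>A \<times> B. f x * g y) = infsum f A * infsum g B"
    using infsum_Sigma_banach[OF *, symmetric]
    by (simp add: infsum_cmult_right' infsum_cmult_left')
  with * show ?thesis by (simp add: has_sum_iff)
qed

lemma has_sum_sum:
  fixes f :: "'i \<Rightarrow> 'a \<Rightarrow> 'b :: topological_comm_monoid_add"
  assumes "finite I" "\<And>i. i \<in> I \<Longrightarrow> (f i has_sum s i) A"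
  shows "((\<lambda>x. \<Sum>i\<in>I. f i x) has_sum (\<Sum>i\<in>I. s i)) A"
  using assms by (induction I rule: finite_induct) (auto intro: has_sum_add has_sum_0)

lemma has_sum_diff:
  fixes f g :: "'a \<Rightarrow> 'b :: topological_ab_group_add"
  assumes "(f has_sum s) A" "(g has_sum t) A"
  shows "((\<lambda>x. f x - g x) has_sum (s - t)) A"
  using has_sum_add[OF assms(1), of "\<lambda>x. - g x" "- t"] assms(2) by (simp add: has_sum_uminus)

section \<open>Lower right Dini derivatives\<close>

text \<open>This says that \<open>D\<close> is at most the lower right Dini derivative of \<open>f\<close> at \<open>t\<close>. Sums over
the lattice are not known to be differentiable in \<open>\<beta>\<close>, since the derivatives of their terms
are not controlled uniformly; one-sided lower bounds survive the passage to infinite sums.\<close>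

definition right_growth :: "(real \<Rightarrow> real) \<Rightarrow> real \<Rightarrow> real \<Rightarrow> bool" where
  "right_growth f t D \<longleftrightarrow> (\<forall>e>0. \<forall>\<^sub>F s in at_right t. f t + (D - e) * (s - t) \<le> f s)"

lemma right_growth_has_derivative:
  assumes "(f has_real_derivative D) (at_right t)"
  shows "right_growth f t D"
  unfolding right_growth_def
proof (intro allI impI)
  fix e :: real assume "0 < e"
  have lim: "((\<lambda>s. (f s - f t) / (s - t)) \<longlongrightarrow> D) (at_right t)"
    using assms by (simp add: has_field_derivative_iff)
  have "\<forall>\<^sub>F s in at_right t. D - e < (f s - f t) / (s - t)"
    by (rule order_tendstoD(1)[OF lim]) (use \<open>0 < e\<close> in simp)
  then show "\<forall>\<^sub>F s in at_right t. f t + (D - e) * (s - t) \<le> f s"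
    using eventually_at_right_less[of t]
  proof eventually_elim
    case (elim s)
    then show ?case by (simp add: pos_less_divide_eq)
  qed
qed

lemma right_growth_minorant:
  assumes "right_growth k t D" "k t = f t" "\<forall>\<^sub>F s in at_right t. k s \<le> f s"
  shows "right_growth f t D"
  unfolding right_growth_def
proof (intro allI impI)
  fix e :: real assume "0 < e"
  then have "\<forall>\<^sub>F s in at_right t. k t + (D - e) * (s - t) \<le> k s"
    using assms(1) by (simp add: right_growth_def)
  then show "\<forall>\<^sub>F s in at_right t. f t + (D - e) * (s - t) \<le> f s"
    using assms(3) by eventually_elim (use assms(2) in simp)
qed

lemma right_growth_mono:
  assumes "right_growth f t D" "D' \<le> D"
  shows "right_growth f t D'"
  unfolding right_growth_def
proof (intro allI impI)
  fix e :: real assume "0 < e"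
  then have "\<forall>\<^sub>F s in at_right t. f t + (D - e) * (s - t) \<le> f s"
    using assms(1) by (simp add: right_growth_def)
  then show "\<forall>\<^sub>F s in at_right t. f t + (D' - e) * (s - t) \<le> f s"
    using eventually_at_right_less[of t]
  proof eventually_elim
    case (elim s)
    have "(D' - e) * (s - t) \<le> (D - e) * (s - t)"
      using elim assms(2) by (intro mult_right_mono) auto
    with elim show ?case by linarith
  qed
qed

lemma right_growth_add:
  assumes "right_growth f t D" "right_growth g t D'"
  shows "right_growth (\<lambda>s. f s + g s) t (D + D')"
  unfolding right_growth_def
proof (intro allI impI)
  fix e :: real assume "0 < e"
  then have "\<forall>\<^sub>F s in at_right t. f t + (D - e / 2) * (s - t) \<le> f s"
    "\<forall>\<^sub>F s in at_right t. g t + (D' - e / 2) * (s - t) \<le> g s"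
    using assms by (simp_all add: right_growth_def)
  then show "\<forall>\<^sub>F s in at_right t. f t + g t + (D + D' - e) * (s - t) \<le> f s + g s"
  proof eventually_elim
    case (elim s)
    have "(D + D' - e) * (s - t) = (D - e / 2) * (s - t) + (D' - e / 2) * (s - t)"
      by (simp add: field_simps)
    with elim show ?case by linarith
  qed
qed

text \<open>Since \<open>g\<close> is monotone, an affine minorant of \<open>f\<close> to the right of \<open>t\<close> turns into a
differentiable minorant of \<open>g \<circ> f\<close>. Monotonicity is asked for on the positive axis only,
because \<open>g\<close> will be \<open>ln\<close> or \<open>\<lambda>y. - (1 / y)\<close>.\<close>

lemma right_growth_compose:
  assumes f: "right_growth f t D"
    and g: "(g has_real_derivative g') (at (f t))" "0 \<le> g'"
    and mono: "\<And>x y. 0 < x \<Longrightarrow> x \<le> y \<Longrightarrow> g x \<le> g y" and pos: "0 < f t"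
  shows "right_growth (\<lambda>s. g (f s)) t (g' * D)"
  unfolding right_growth_def
proof (intro allI impI)
  fix e :: real assume e: "0 < e"
  \<comment> \<open>The denominator is shifted by 1 to cover the case of a vanishing derivative of \<open>g\<close>.\<close>
  define d where "d = e / (2 * (g' + 1))"
  have d: "0 < d" "g' * d \<le> e / 2" using e g(2) by (auto simp: d_def field_simps)
  define k where "k = (\<lambda>s. f t + (D - d) * (s - t))"
  have kt: "k t = f t" by (simp add: k_def)
  have "((\<lambda>s. g (k s)) has_real_derivative g' * (D - d)) (at_right t)"
    by (rule DERIV_chain2) (use g(1) in \<open>auto simp: k_def intro!: derivative_eq_intros\<close>)
  then have "right_growth (\<lambda>s. g (k s)) t (g' * (D - d))"
    by (rule right_growth_has_derivative)
  then have "\<forall>\<^sub>F s in at_right t. g (k t) + (g' * (D - d) - e / 2) * (s - t) \<le> g (k s)"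
    using e by (simp add: right_growth_def)
  moreover have "\<forall>\<^sub>F s in at_right t. k s \<le> f s"
    using f d by (simp add: right_growth_def k_def)
  moreover have "\<forall>\<^sub>F s in at_right t. 0 < k s"
  proof (rule order_tendstoD(1))
    show "(k \<longlongrightarrow> f t) (at_right t)"
      unfolding k_def by (auto intro!: tendsto_eq_intros)
  qed (use pos in simp)
  ultimately show "\<forall>\<^sub>F s in at_right t. g (f t) + (g' * D - e) * (s - t) \<le> g (f s)"
    using eventually_at_right_less[of t]
  proof eventually_elim
    case (elim s)
    have "(g' * D - e) * (s - t) \<le> (g' * (D - d) - e / 2) * (s - t)"
      using elim d by (intro mult_right_mono) (auto simp: algebra_simps)
    then have "g (f t) + (g' * D - e) * (s - t) \<le> g (k s)"
      using elim(1) unfolding kt by linarith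
    also have "\<dots> \<le> g (f s)"
      using elim by (intro mono) auto
    finally show ?case .
  qed
qed

text \<open>If \<open>f b < f a\<close>, tilt \<open>f\<close> by a slope \<open>e\<close> so small that the tilted function \<open>g\<close> is still
negative at \<open>b\<close>. At the last point where \<open>g \<ge> 0\<close>, the growth condition makes \<open>g\<close>
nonnegative slightly further to the right, a contradiction.\<close>

lemma right_growth_nonneg_imp_le:
  assumes "a \<le> b" and cont: "continuous_on {a..b} f"
    and growth: "\<And>t. a \<le> t \<Longrightarrow> t < b \<Longrightarrow> right_growth f t 0"
  shows "f a \<le> f b"
proof (rule ccontr)
  assume "\<not> f a \<le> f b"
  then have less: "f b < f a" and ab: "a < b" using assms(1) by (auto simp: less_le)
  \<comment> \<open>Half the mean slope of descent.\<close>
  define e where "e = (f a - f b) / 2 / (b - a)"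
  have e: "0 < e" "e * (b - a) = (f a - f b) / 2" using less ab by (simp_all add: e_def del: divide_divide_eq_left)
  define g where "g = (\<lambda>s. f s - f a + e * (s - a))"
  have gb: "g b < 0" using e less by (simp add: g_def)
  define S where "S = {a..b} \<inter> g -` {0..}"
  have "closed S" unfolding S_def g_def
    by (intro continuous_closed_preimage continuous_intros cont)
  moreover have "bounded S"
    by (rule bounded_subset[of "{a..b}"]) (auto simp: S_def)
  ultimately have "compact S"
    by (simp add: compact_eq_bounded_closed)
  moreover have "a \<in> S" using ab by (auto simp: S_def g_def)
  ultimately obtain t where t: "t \<in> S" "\<And>s. s \<in> S \<Longrightarrow> s \<le> t"
    using compact_attains_sup[of S] by auto
  have "t \<noteq> b" using gb t by (auto simp: S_def)
  with t have tb: "a \<le> t" "t < b" "0 \<le> g t" by (auto simp: S_def)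
  have "\<forall>\<^sub>F s in at_right t. f t + (0 - e) * (s - t) \<le> f s"
    using growth[OF tb(1,2)] e by (simp add: right_growth_def)
  moreover have "\<forall>\<^sub>F s in at_right t. s \<in> {t<..<b}"
    using tb(2) by (rule eventually_at_right_real)
  ultimately have "\<forall>\<^sub>F s in at_right t. False"
  proof eventually_elim
    case (elim s)
    then have "g t \<le> g s" by (auto simp: g_def algebra_simps)
    then have "s \<in> S" using tb elim by (auto simp: S_def)
    with t(2)[of s] elim show False by auto
  qed
  then show False by simp
qed

lemma right_growth_cmult:
  assumes "right_growth f t D" "0 \<le> c"
  shows "right_growth (\<lambda>s. c * f s) t (c * D)"
  unfolding right_growth_def
proof (intro allI impI)
  fix e :: real assume e: "0 < e"
  define d where "d = e / (c + 1)"
  have d: "0 < d" "c * d \<le> e" using e assms(2) by (auto simp: d_def field_simps)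
  have "\<forall>\<^sub>F s in at_right t. f t + (D - d) * (s - t) \<le> f s"
    using assms(1) d by (simp add: right_growth_def)
  then show "\<forall>\<^sub>F s in at_right t. c * f t + (c * D - e) * (s - t) \<le> c * f s"
    using eventually_at_right_less[of t]
  proof eventually_elim
    case (elim s)
    have "(c * D - e) * (s - t) \<le> (c * (D - d)) * (s - t)"
      using elim d by (intro mult_right_mono) (auto simp: algebra_simps)
    moreover have "c * (f t + (D - d) * (s - t)) \<le> c * f s"
      using elim assms(2) by (intro mult_left_mono) auto
    ultimately show ?case by (simp add: algebra_simps)
  qed
qed

lemma right_growth_sum:
  assumes "finite F" "\<And>x. x \<in> F \<Longrightarrow> right_growth (f x) t (D x)"
  shows "right_growth (\<lambda>s. \<Sum>x\<in>F. f x s) t (\<Sum>x\<in>F. D x)"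
  using assms
proof (induction F rule: finite_induct)
  case empty
  show ?case by (rule right_growth_has_derivative) simp
next
  case (insert x F)
  then show ?case by (simp add: right_growth_add)
qed

text \<open>This replaces differentiation under the summation sign. A finite part of the sum almost attains the
derivative, and the omitted terms can only increase because \<open>g\<close> is monotone in its parameter
and the weights are nonnegative.\<close>

lemma right_growth_infsum:
  fixes g :: "real \<Rightarrow> 'a \<Rightarrow> real"
  assumes "t < b" and w: "\<And>x. 0 \<le> w x"
    and summable: "\<And>s. t \<le> s \<Longrightarrow> s < b \<Longrightarrow> (\<lambda>x. w x * g s x) summable_on UNIV"
      "(\<lambda>x. w x * k x) summable_on UNIV"
    and mono: "\<And>s x. t \<le> s \<Longrightarrow> s < b \<Longrightarrow> g t x \<le> g s x"
    and growth: "\<And>x. right_growth (\<lambda>s. g s x) t (k x)"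
  shows "right_growth (\<lambda>s. \<Sum>\<^sub>\<infinity>x\<in>UNIV. w x * g s x) t (\<Sum>\<^sub>\<infinity>x\<in>UNIV. w x * k x)"
    (is "right_growth ?W t ?K")
  unfolding right_growth_def
proof (intro allI impI)
  fix e :: real assume e: "0 < e"
  obtain F where F: "finite F" "dist (\<Sum>x\<in>F. w x * k x) ?K \<le> e / 2"
    using has_sum_finite_approximation[OF has_sum_infsum[OF summable(2)], of "e / 2"] e by auto
  define D where "D = (\<Sum>x\<in>F. w x * k x)"
  have D: "?K - e / 2 \<le> D" using F(2) unfolding D_def dist_real_def by linarith
  have "right_growth (\<lambda>s. \<Sum>x\<in>F. w x * g s x) t D"
    unfolding D_def by (intro right_growth_sum F right_growth_cmult growth w)
  then have "\<forall>\<^sub>F s in at_right t.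
      (\<Sum>x\<in>F. w x * g t x) + (D - e / 2) * (s - t) \<le> (\<Sum>x\<in>F. w x * g s x)"
    using e by (simp add: right_growth_def)
  moreover have "\<forall>\<^sub>F s in at_right t. s \<in> {t<..<b}"
    using \<open>t < b\<close> by (rule eventually_at_right_real)
  ultimately show "\<forall>\<^sub>F s in at_right t. ?W t + (?K - e) * (s - t) \<le> ?W s"
  proof eventually_elim
    case (elim s)
    then have s: "t \<le> s" "s < b" by auto
    have diff: "((\<lambda>x. w x * g s x - w x * g t x) has_sum (?W s - ?W t)) UNIV"
      using s \<open>t < b\<close> by (intro has_sum_diff has_sum_infsum summable) auto
    have "(\<Sum>x\<in>F. w x * g s x - w x * g t x) \<le> (\<Sum>\<^sub>\<infinity>x\<in>UNIV. w x * g s x - w x * g t x)"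
      using F(1) w mono[OF s]
      by (intro finite_sum_le_infsum has_sum_imp_summable[OF diff]) (auto intro: mult_left_mono)
    then have "(\<Sum>x\<in>F. w x * g s x) - (\<Sum>x\<in>F. w x * g t x) \<le> ?W s - ?W t"
      unfolding infsumI[OF diff] by (simp add: sum_subtractf)
    moreover have "(?K - e) * (s - t) \<le> (D - e / 2) * (s - t)"
      using D s by (intro mult_right_mono) auto
    ultimately show ?case using elim by linarith
  qed
qed

lemma mono_lipschitz_imp_continuous_on:
  fixes f :: "real \<Rightarrow> real"
  assumes mono: "\<And>s t. 0 \<le> s \<Longrightarrow> s \<le> t \<Longrightarrow> t \<le> u \<Longrightarrow> f s \<le> f t"
    and upper: "\<And>s t. 0 \<le> s \<Longrightarrow> s \<le> t \<Longrightarrow> t \<le> u \<Longrightarrow> f t \<le> f s + (t - s) * C"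
    and "0 \<le> C"
  shows "continuous_on {0..u} f"
proof (rule lipschitz_on_continuous_on)
  show "C-lipschitz_on {0..u} f"
  proof (rule lipschitz_onI)
    fix s t assume st: "s \<in> {0..u}" "t \<in> {0..u}"
    show "dist (f s) (f t) \<le> C * dist s t"
    proof (cases "s \<le> t")
      case True
      with mono[of s t] upper[of s t] st show ?thesis by (auto simp: dist_real_def mult.commute)
    next
      case False
      with mono[of t s] upper[of t s] st show ?thesis by (auto simp: dist_real_def mult.commute)
    qed
  qed fact
qed

section \<open>Differential inequalities that determine the critical exponents\<close>

text \<open>Here \<open>chi\<close> stands for the susceptibility and \<open>M\<close> for the unnormalised second moment, so that
\<open>M / chi\<close> is the square of the correlation length. The hypotheses are integrated and Dini forms of
\<open>(1 - e) chi\<^sup>2 \<le> chi' \<le> chi\<^sup>2\<close> and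
\<open>2 (1 - e) M chi \<le> M' \<le> 2 M chi\<close>.\<close>

locale critical_growth =
  fixes chi M :: "real \<Rightarrow> real" and b e :: real
  assumes b: "0 < b" and e: "0 \<le> e" "e < 1 / 2"
    and chi_0: "chi 0 = 1" and M_0: "0 < M 0"
    and chi_mono: "\<And>s t. 0 \<le> s \<Longrightarrow> s \<le> t \<Longrightarrow> t < b \<Longrightarrow> chi s \<le> chi t"
    and M_mono: "\<And>s t. 0 \<le> s \<Longrightarrow> s \<le> t \<Longrightarrow> t < b \<Longrightarrow> M s \<le> M t"
    and chi_upper: "\<And>s t. 0 \<le> s \<Longrightarrow> s \<le> t \<Longrightarrow> t < b \<Longrightarrow>
      chi t \<le> chi s + (t - s) * (chi s * chi t)"
    and M_upper: "\<And>s t. 0 \<le> s \<Longrightarrow> s \<le> t \<Longrightarrow> t < b \<Longrightarrow>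
      M t \<le> M s + (t - s) * (M s * chi t + chi s * M t)"
    and chi_lower: "\<And>t. 0 \<le> t \<Longrightarrow> t < b \<Longrightarrow> right_growth chi t ((1 - e) * (chi t)\<^sup>2)"
    and M_lower: "\<And>t. 0 \<le> t \<Longrightarrow> t < b \<Longrightarrow> right_growth M t (2 * (1 - e) * (M t * chi t))"
begin

lemma chi_ge_1: "0 \<le> t \<Longrightarrow> t < b \<Longrightarrow> 1 \<le> chi t"
  using chi_mono[of 0 t] chi_0 by simp

lemma M_pos: "0 \<le> t \<Longrightarrow> t < b \<Longrightarrow> 0 < M t"
  using M_mono[of 0 t] M_0 by simp

lemma continuous_chi:
  assumes "u < b" shows "continuous_on {0..u} chi"
proof (cases "0 \<le> u")
  case True
  show ?thesis
  proof (rule mono_lipschitz_imp_continuous_on)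
    fix s t assume st: "0 \<le> s" "s \<le> t" "t \<le> u"
    have "chi s * chi t \<le> chi u * chi u"
      using st assms chi_ge_1[of s] chi_ge_1[of t] chi_mono[of s u] chi_mono[of t u] by (intro mult_mono) auto
    then have "(t - s) * (chi s * chi t) \<le> (t - s) * (chi u * chi u)"
      using st by (intro mult_left_mono) auto
    then show "chi t \<le> chi s + (t - s) * (chi u * chi u)"
      using chi_upper[of s t] st assms by linarith
  qed (use chi_mono assms in auto)
qed simp

lemma continuous_M:
  assumes "u < b" shows "continuous_on {0..u} M"
proof (cases "0 \<le> u")
  case True
  show ?thesis
  proof (rule mono_lipschitz_imp_continuous_on)
    fix s t assume st: "0 \<le> s" "s \<le> t" "t \<le> u"
    have "M s * chi t \<le> M u * chi u" "chi s * M t \<le> M u * chi u"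
      using st assms chi_ge_1[of s] chi_ge_1[of t] chi_mono[of s u] chi_mono[of t u]
        M_pos[of s] M_pos[of t] M_mono[of s u] M_mono[of t u]
      by (auto intro: mult_mono simp: mult.commute[of "chi s"])
    then have "(t - s) * (M s * chi t + chi s * M t) \<le> (t - s) * (2 * (M u * chi u))"
      using st by (intro mult_left_mono) auto
    then show "M t \<le> M s + (t - s) * (2 * (M u * chi u))"
      using M_upper[of s t] st assms by linarith
  next
    show "0 \<le> 2 * (M u * chi u)" using M_pos[of u] chi_ge_1[of u] True assms by auto
  qed (use M_mono assms in auto)
qed simp

text \<open>The inequalities for \<open>chi'\<close> become \<open>1 - e \<le> - (1 / chi)' \<le> 1\<close> after division by
\<open>chi\<^sup>2\<close>, with constant bounds.\<close>

lemma inverse_chi_decrease: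
  assumes "0 \<le> s" "s \<le> t" "t < b"
  shows "1 / chi s - 1 / chi t \<le> t - s" "(1 - e) * (t - s) \<le> 1 / chi s - 1 / chi t"
proof -
  have pos: "0 < chi s" "0 < chi t" using chi_ge_1[of s] chi_ge_1[of t] assms by auto
  show "1 / chi s - 1 / chi t \<le> t - s"
    using chi_upper[OF assms] pos by (simp add: field_simps)
  have "- (1 / chi s) - (1 - e) * s \<le> - (1 / chi t) - (1 - e) * t"
  proof (rule right_growth_nonneg_imp_le[where f = "\<lambda>s. - (1 / chi s) - (1 - e) * s"])
    show "s \<le> t" by fact
    have "chi x \<noteq> 0" if "x \<in> {s..t}" for x
      using chi_ge_1[of x] assms that by auto
    then show "continuous_on {s..t} (\<lambda>s. - (1 / chi s) - (1 - e) * s)"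
      using assms by (intro continuous_intros continuous_on_subset[OF continuous_chi[of t]]) auto
  next
    fix u assume "s \<le> u" "u < t"
    then have u: "0 \<le> u" "u < b" using assms by auto
    have cu: "1 \<le> chi u" using chi_ge_1 u by auto
    have "right_growth (\<lambda>s. - (1 / chi s)) u (1 / (chi u)\<^sup>2 * ((1 - e) * (chi u)\<^sup>2))"
      by (rule right_growth_compose[OF chi_lower[OF u], where g = "\<lambda>y. - (1 / y)"])
        (use cu in \<open>auto intro!: derivative_eq_intros simp: power2_eq_square divide_simps\<close>)
    then have "right_growth (\<lambda>s. - (1 / chi s)) u (1 - e)"
      using cu by simp
    moreover have "right_growth (\<lambda>s. - ((1 - e) * s)) u (- (1 - e))"
      by (rule right_growth_has_derivative) (auto intro!: derivative_eq_intros)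
    ultimately show "right_growth (\<lambda>s. - (1 / chi s) - (1 - e) * s) u 0"
      by (auto dest: right_growth_add)
  qed
  then show "(1 - e) * (t - s) \<le> 1 / chi s - 1 / chi t"
    by (simp add: algebra_simps)
qed

text \<open>The function \<open>1 / chi\<close> starts at 1, decreases at rate at least \<open>1 - e\<close> and stays positive,
which bounds the length of the interval on which \<open>chi\<close> can be finite.\<close>

lemma b_le: "b \<le> 1 / (1 - e)"
proof (rule dense_le_bounded[of 0])
  show "0 < b" by (fact b)
  fix t assume "0 < t" "t < b"
  then have "(1 - e) * t \<le> 1 - 1 / chi t" and pos: "0 < 1 / chi t"
    using inverse_chi_decrease(2)[of 0 t] chi_0 chi_ge_1[of t] by auto
  then have "(1 - e) * t \<le> 1" by linarith
  then show "t \<le> 1 / (1 - e)" using e by (simp add: field_simps)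
qed

text \<open>The integrated upper bounds can be solved for their right endpoint: with \<open>q s = 1 - (s - t) chi t\<close>
they give \<open>chi s \<le> chi t / q s\<close> and \<open>M s \<le> M t / (q s)\<^sup>2\<close>. The logarithms of these
majorants are differentiable at \<open>t\<close>.\<close>

lemma growth_minus_ln:
  assumes t: "0 \<le> t" "t < b"
  shows "right_growth (\<lambda>s. - ln (chi s)) t (- chi t)"
    and "right_growth (\<lambda>s. - ln (M s)) t (- 2 * chi t)"
proof -
  have pos: "0 < chi t" "0 < M t" using M_pos[OF t] chi_ge_1[OF t] by auto
  define q where "q = (\<lambda>s. 1 - (s - t) * chi t)"
  have "\<forall>\<^sub>F s in at_right t. 0 < q s"
  proof (rule order_tendstoD(1))
    show "(q \<longlongrightarrow> 1) (at_right t)"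
      unfolding q_def by (auto intro!: tendsto_eq_intros)
  qed simp
  moreover have "\<forall>\<^sub>F s in at_right t. s \<in> {t<..<b}"
    using t(2) by (rule eventually_at_right_real)
  ultimately have ev: "\<forall>\<^sub>F s in at_right t. q s * chi s \<le> chi t \<and> (q s)\<^sup>2 * M s \<le> M t
      \<and> 0 < q s \<and> 0 < chi s \<and> 0 < M s"
  proof eventually_elim
    case (elim s)
    then have s: "t \<le> s" "s < b" "0 \<le> s" using t by auto
    have 1: "q s * chi s \<le> chi t"
      using chi_upper[OF t(1) s(1,2)] by (simp add: q_def algebra_simps)
    have Ms: "0 < M s" "0 < chi s" using M_pos[OF s(3,2)] chi_ge_1[OF s(3,2)] by auto
    \<comment> \<open>Multiplying once more by \<open>q s\<close> eliminates \<open>chi s\<close> from the right-hand side.\<close>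
    have "q s * M s \<le> M t * (1 + (s - t) * chi s)"
      using M_upper[OF t(1) s(1,2)] by (simp add: q_def algebra_simps)
    then have "q s * (q s * M s) \<le> q s * (M t * (1 + (s - t) * chi s))"
      using elim by (intro mult_left_mono) auto
    also have "\<dots> = M t * (q s + (s - t) * (q s * chi s))"
      by (simp add: algebra_simps)
    also have "\<dots> \<le> M t * (q s + (s - t) * chi t)"
      using 1 s pos by (intro mult_left_mono add_left_mono) auto
    also have "\<dots> = M t" by (simp add: q_def)
    finally show ?case using 1 Ms elim by (simp add: power2_eq_square)
  qed
  show "right_growth (\<lambda>s. - ln (chi s)) t (- chi t)"
  proof (rule right_growth_minorant)
    show "right_growth (\<lambda>s. ln (q s) - ln (chi t)) t (- chi t)"
      by (rule right_growth_has_derivative) (auto intro!: derivative_eq_intros simp: q_def)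
    show "ln (q t) - ln (chi t) = - ln (chi t)" by (simp add: q_def)
    show "\<forall>\<^sub>F s in at_right t. ln (q s) - ln (chi t) \<le> - ln (chi s)"
      using ev
    proof eventually_elim
      case (elim s)
      then have "ln (q s * chi s) \<le> ln (chi t)" using pos by (subst ln_le_cancel_iff) auto
      then show ?case using elim by (simp add: ln_mult_pos)
    qed
  qed
  show "right_growth (\<lambda>s. - ln (M s)) t (- 2 * chi t)"
  proof (rule right_growth_minorant)
    show "right_growth (\<lambda>s. 2 * ln (q s) - ln (M t)) t (- 2 * chi t)"
      by (rule right_growth_has_derivative) (auto intro!: derivative_eq_intros simp: q_def)
    show "2 * ln (q t) - ln (M t) = - ln (M t)" by (simp add: q_def)
    show "\<forall>\<^sub>F s in at_right t. 2 * ln (q s) - ln (M t) \<le> - ln (M s)"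
      using ev
    proof eventually_elim
      case (elim s)
      then have "ln ((q s)\<^sup>2 * M s) \<le> ln (M t)" using pos by (subst ln_le_cancel_iff) auto
      then show ?case using elim by (simp add: ln_mult_pos ln_realpow)
    qed
  qed
qed

lemma growth_ln:
  assumes t: "0 \<le> t" "t < b"
  shows "right_growth (\<lambda>s. ln (chi s)) t ((1 - e) * chi t)"
    and "right_growth (\<lambda>s. ln (M s)) t (2 * (1 - e) * chi t)"
proof -
  have pos: "0 < chi t" "0 < M t" using M_pos[OF t] chi_ge_1[OF t] by auto
  show "right_growth (\<lambda>s. ln (chi s)) t ((1 - e) * chi t)"
    using right_growth_compose[OF chi_lower[OF t], of ln "1 / chi t"] pos
    by (auto intro!: DERIV_ln_divide simp: power2_eq_square)
  show "right_growth (\<lambda>s. ln (M s)) t (2 * (1 - e) * chi t)"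
    using right_growth_compose[OF M_lower[OF t], of ln "1 / M t"] pos
    by (auto intro!: DERIV_ln_divide simp: power2_eq_square)
qed

text \<open>Divergence of \<open>chi\<close> at \<open>b\<close> turns the bounds on \<open>1 / chi\<close> into two-sided bounds
on \<open>chi\<close>.\<close>

context
  assumes blow_up: "\<And>B. \<exists>t. 0 \<le> t \<and> t < b \<and> B < chi t"
begin

lemma chi_bounds:
  assumes t: "0 \<le> t" "t < b"
  shows "1 / (b - t) \<le> chi t" "chi t \<le> 1 / ((1 - e) * (b - t))"
proof -
  have ct: "0 < chi t" using chi_ge_1[OF t] by auto
  have "1 / chi t \<le> b - t"
  proof (rule field_le_epsilon)
    fix d :: real assume d: "0 < d"
    obtain u where u: "0 \<le> u" "u < b" "max (1 / d) (chi t) < chi u" using blow_up by blast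
    have "t \<le> u" using chi_mono[of u t] u t by linarith
    have "1 / chi u < d" using u d ct by (auto simp: field_simps)
    then show "1 / chi t \<le> b - t + d"
      using inverse_chi_decrease(1)[OF t(1) \<open>t \<le> u\<close> u(2)] u by linarith
  qed
  then show "1 / (b - t) \<le> chi t" using ct t by (simp add: field_simps)
  have "(1 - e) * (b - t) \<le> 1 / chi t"
  proof -
    have "u \<le> t + 1 / (chi t * (1 - e))" if "t < u" "u < b" for u
    proof -
      have "0 \<le> 1 / chi u" using chi_ge_1[of u] t that by auto
      moreover have "(1 - e) * (u - t) \<le> 1 / chi t - 1 / chi u"
        using inverse_chi_decrease(2)[of t u] t that by simp
      ultimately have "(1 - e) * (u - t) \<le> 1 / chi t" by linarith
      then show ?thesis using e ct by (simp add: field_simps)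
    qed
    then have "b \<le> t + 1 / (chi t * (1 - e))" by (rule dense_le_bounded[OF t(2)])
    then show ?thesis using e ct by (simp add: field_simps)
  qed
  moreover have "0 < (1 - e) * (b - t)" using e t by simp
  ultimately show "chi t \<le> 1 / ((1 - e) * (b - t))" using ct by (simp add: field_simps)
qed

lemma b_ge_1: "1 \<le> b"
  using chi_bounds(1)[of 0] b chi_0 by (simp add: field_simps)

text \<open>The two pairs of inequalities for \<open>chi'\<close> and \<open>M'\<close> combine to
\<open>(1 - 2 * e) * chi \<le> (ln (M / chi))' \<le> (1 + e) * chi\<close>; inserting the bounds on \<open>chi\<close>
leaves multiples of \<open>1 / (b - t)\<close>, whose primitive is \<open>- ln (b - t)\<close>. The sign of
\<open>1 - 2 * e\<close> is what makes the lower bound on \<open>chi\<close> applicable.\<close>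

lemma ln_ratio_bounds:
  assumes t: "0 \<le> t" "t < b"
  shows "(1 - 2 * e) * ln (b / (b - t)) \<le> ln (M t / chi t) - ln (M 0)"
    and "ln (M t / chi t) - ln (M 0) \<le> (1 + e) / (1 - e) * ln (b / (b - t))"
proof -
  have pos: "0 < chi x" "0 < M x" if "x \<in> {0..t}" for x
    using M_pos[of x] chi_ge_1[of x] that t by auto
  have cont: "continuous_on {0..t} (\<lambda>s. ln (M s))" "continuous_on {0..t} (\<lambda>s. ln (chi s))"
    using pos by (force intro!: continuous_intros continuous_M continuous_chi t)+
  have Lt: "ln (M t / chi t) = ln (M t) - ln (chi t)" "ln (b / (b - t)) = ln b - ln (b - t)"
    using pos[of t] b t by (auto simp: ln_div)
  have "ln (M 0) - ln (chi 0) + (1 - 2 * e) * ln (b - 0)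
      \<le> ln (M t) - ln (chi t) + (1 - 2 * e) * ln (b - t)"
  proof (rule right_growth_nonneg_imp_le[where f = "\<lambda>s. ln (M s) - ln (chi s) + (1 - 2 * e) * ln (b - s)"])
    show "continuous_on {0..t} (\<lambda>s. ln (M s) - ln (chi s) + (1 - 2 * e) * ln (b - s))"
      by (intro continuous_intros cont) (use t in auto)
    fix u assume "0 \<le> u" "u < t"
    then have u: "0 \<le> u" "u < b" using t by auto
    have "right_growth (\<lambda>s. (1 - 2 * e) * ln (b - s)) u (- ((1 - 2 * e) / (b - u)))"
      by (rule right_growth_has_derivative) (use u in \<open>auto intro!: derivative_eq_intros simp: diff_divide_distrib\<close>)
    note right_growth_add[OF right_growth_add[OF growth_ln(2) growth_minus_ln(1)] this, OF u u]
    moreover have "(1 - 2 * e) / (b - u) \<le> (1 - 2 * e) * chi u"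
      using mult_left_mono[OF chi_bounds(1)[OF u], of "1 - 2 * e"] e by simp
    ultimately show "right_growth (\<lambda>s. ln (M s) - ln (chi s) + (1 - 2 * e) * ln (b - s)) u 0"
      by (auto intro: right_growth_mono simp: algebra_simps)
  qed (use t in auto)
  then show "(1 - 2 * e) * ln (b / (b - t)) \<le> ln (M t / chi t) - ln (M 0)"
    unfolding Lt by (simp add: chi_0 algebra_simps)
  define p where "p = (1 + e) / (1 - e)"
  have "ln (chi 0) - ln (M 0) - p * ln (b - 0) \<le> ln (chi t) - ln (M t) - p * ln (b - t)"
  proof (rule right_growth_nonneg_imp_le[where f = "\<lambda>s. ln (chi s) - ln (M s) - p * ln (b - s)"])
    show "continuous_on {0..t} (\<lambda>s. ln (chi s) - ln (M s) - p * ln (b - s))"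
      by (intro continuous_intros cont) (use t in auto)
    fix u assume "0 \<le> u" "u < t"
    then have u: "0 \<le> u" "u < b" using t by auto
    have "right_growth (\<lambda>s. - (p * ln (b - s))) u (p * (1 / (b - u)))"
      by (rule right_growth_has_derivative) (use u in \<open>auto intro!: derivative_eq_intros\<close>)
    note right_growth_add[OF right_growth_add[OF growth_ln(1) growth_minus_ln(2)] this, OF u u]
    moreover have "(1 + e) * chi u \<le> p * (1 / (b - u))"
      using mult_left_mono[OF chi_bounds(2)[OF u], of "1 + e"] e by (simp add: p_def)
    ultimately show "right_growth (\<lambda>s. ln (chi s) - ln (M s) - p * ln (b - s)) u 0"
      by (auto intro: right_growth_mono simp: algebra_simps)
  qed (use t in auto)
  then show "ln (M t / chi t) - ln (M 0) \<le> (1 + e) / (1 - e) * ln (b / (b - t))"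
    unfolding Lt p_def[symmetric] by (simp add: chi_0 algebra_simps)
qed

text \<open>The exact integration yields powers of \<open>b / (b - t)\<close>; the factor \<open>b\<close> is then replaced by its
lower bound 1 or its upper bound \<open>1 / (1 - e)\<close>.\<close>

lemma ratio_bounds:
  assumes t: "0 \<le> t" "t < b"
  shows "(1 / (b - t)) powr (1 - 2 * e) \<le> M t / chi t / M 0"
    and "M t / chi t / M 0 \<le> (1 / ((1 - e) * (b - t))) powr ((1 + e) / (1 - e))"
proof -
  have pos: "0 < chi t" "0 < M t" using M_pos[OF t] chi_ge_1[OF t] by auto
  have R: "M t / chi t / M 0 = exp (ln (M t / chi t) - ln (M 0))"
    using pos M_0 by (simp add: exp_diff)
  have "(1 / (b - t)) powr (1 - 2 * e) \<le> (b / (b - t)) powr (1 - 2 * e)"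
    using b_ge_1 t e by (intro powr_mono2 divide_right_mono) auto
  also have "\<dots> = exp ((1 - 2 * e) * ln (b / (b - t)))"
    using b t by (simp add: powr_def)
  also have "\<dots> \<le> M t / chi t / M 0"
    unfolding R using ln_ratio_bounds(1)[OF t] by simp
  finally show "(1 / (b - t)) powr (1 - 2 * e) \<le> M t / chi t / M 0" .
  have "M t / chi t / M 0 \<le> exp ((1 + e) / (1 - e) * ln (b / (b - t)))"
    unfolding R using ln_ratio_bounds(2)[OF t] by simp
  also have "\<dots> = (b / (b - t)) powr ((1 + e) / (1 - e))"
    using b t by (simp add: powr_def)
  also have "\<dots> \<le> (1 / ((1 - e) * (b - t))) powr ((1 + e) / (1 - e))"
  proof (intro powr_mono2)
    show "b / (b - t) \<le> 1 / ((1 - e) * (b - t))"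
      using divide_right_mono[OF b_le, of "b - t"] t by simp
  qed (use b t e in auto)
  finally show "M t / chi t / M 0 \<le> (1 / ((1 - e) * (b - t))) powr ((1 + e) / (1 - e))" .
qed

end

end

section \<open>Moments of convolutions of even functions\<close>

lemma eucl_sq_nonneg [simp]: "0 \<le> eucl_sq x"
  by (simp add: eucl_sq_def sum_nonneg)

lemma eucl_sq_0 [simp]: "eucl_sq 0 = 0"
  by (simp add: eucl_sq_def)

lemma eucl_sq_minus [simp]: "eucl_sq (- x) = eucl_sq x"
  by (simp add: eucl_sq_def)

lemma eucl_sq_add:
  "eucl_sq (y + z) = eucl_sq y + eucl_sq z + 2 * (\<Sum>i\<in>UNIV. real_of_int (y $ i) * real_of_int (z $ i))"
  by (simp add: eucl_sq_def power2_sum sum.distrib sum_distrib_left algebra_simps)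

lemma eucl_sq_add_le: "eucl_sq (y + z) \<le> 2 * eucl_sq y + 2 * eucl_sq z"
  unfolding eucl_sq_def sum_distrib_left sum.distrib[symmetric]
proof (rule sum_mono)
  fix i
  show "(real_of_int ((y + z) $ i))\<^sup>2 \<le> 2 * (real_of_int (y $ i))\<^sup>2 + 2 * (real_of_int (z $ i))\<^sup>2"
    using zero_le_power2[of "real_of_int (y $ i) - real_of_int (z $ i)"]
    by (simp add: power2_sum power2_diff)
qed

lemma abs_coord_le: "\<bar>real_of_int (x $ i)\<bar> \<le> 1 + eucl_sq x"
proof -
  have "\<bar>real_of_int (x $ i)\<bar> \<le> 1 + (real_of_int (x $ i))\<^sup>2"
    using zero_le_power2[of "\<bar>real_of_int (x $ i)\<bar> - 1"] by (simp add: power2_diff)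
  also have "(real_of_int (x $ i))\<^sup>2 \<le> eucl_sq x"
    unfolding eucl_sq_def by (rule member_le_sum) auto
  finally show ?thesis by simp
qed


definition mass :: "(int ^ 'd \<Rightarrow> real) \<Rightarrow> real" where
  "mass f = (\<Sum>\<^sub>\<infinity>x\<in>UNIV. f x)"

definition moment2 :: "(int ^ 'd \<Rightarrow> real) \<Rightarrow> real" where
  "moment2 f = (\<Sum>\<^sub>\<infinity>x\<in>UNIV. eucl_sq x * f x)"

text \<open>Evenness makes the first moments vanish, and summability against \<open>1 + eucl_sq\<close> makes mass and
second moment absolutely convergent. The class is closed under differences and convolutions, and
signed functions are included because of the kernel \<open>J - H\<close>.\<close>

definition moment_kernel :: "(int ^ 'd \<Rightarrow> real) \<Rightarrow> bool" where
  "moment_kernel f \<longleftrightarrow> (\<forall>x. f (- x) = f x) \<and> (\<lambda>x. (1 + eucl_sq x) * f x) summable_on UNIV"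

lemma moment_kernel_summable:
  assumes "moment_kernel f" and "\<And>x. \<bar>u x\<bar> \<le> C * (1 + eucl_sq x)"
  shows "(\<lambda>x. u x * f x) summable_on UNIV"
proof -
  have "(\<lambda>x. \<bar>(1 + eucl_sq x) * f x\<bar>) summable_on UNIV"
    using assms(1) summable_on_iff_abs_summable_on_real[of "\<lambda>x. (1 + eucl_sq x) * f x" UNIV]
    by (simp add: moment_kernel_def)
  then have "(\<lambda>x. C * \<bar>(1 + eucl_sq x) * f x\<bar>) summable_on UNIV"
    by (rule summable_on_cmult_right)
  then have "(\<lambda>x. norm (u x * f x)) summable_on UNIV"
  proof (rule Infinite_Sum.abs_summable_on_comparison_test'[where g = "\<lambda>x. C * \<bar>(1 + eucl_sq x) * f x\<bar>"])
    fix x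
    have "\<bar>u x\<bar> * \<bar>f x\<bar> \<le> C * (1 + eucl_sq x) * \<bar>f x\<bar>"
      by (intro mult_right_mono assms) auto
    then show "norm (u x * f x) \<le> C * \<bar>(1 + eucl_sq x) * f x\<bar>"
      by (simp add: abs_mult mult.assoc)
  qed
  then show ?thesis using summable_on_iff_abs_summable_on_real by blast
qed

lemma moment_kernel_summable_0: "moment_kernel f \<Longrightarrow> f summable_on UNIV"
  using moment_kernel_summable[of f "\<lambda>_. 1" 1] by simp

lemma moment_kernel_summable_2: "moment_kernel f \<Longrightarrow> (\<lambda>x. eucl_sq x * f x) summable_on UNIV"
  using moment_kernel_summable[of f eucl_sq 1] by simp

lemma moment_kernel_summable_1:
  assumes "moment_kernel f"
  shows "(\<lambda>x. real_of_int (x $ i) * f x) summable_on UNIV"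
  by (rule moment_kernel_summable[OF assms, of _ 1]) (use abs_coord_le in auto)

lemma moment_kernel_first_moment:
  assumes "moment_kernel f"
  shows "(\<Sum>\<^sub>\<infinity>x\<in>UNIV. real_of_int (x $ i) * f x) = 0"
proof -
  have "(\<Sum>\<^sub>\<infinity>x\<in>UNIV. real_of_int (x $ i) * f x) = (\<Sum>\<^sub>\<infinity>x\<in>UNIV. - (real_of_int (x $ i) * f x))"
    by (rule infsum_reindex_bij_witness[of _ uminus uminus]) (use assms in \<open>auto simp: moment_kernel_def\<close>)
  also have "\<dots> = - (\<Sum>\<^sub>\<infinity>x\<in>UNIV. real_of_int (x $ i) * f x)"
    by (rule infsum_uminus)
  finally show ?thesis by simp
qed

lemma moment_kernel_diff:
  assumes "moment_kernel f" "moment_kernel g"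
  shows "moment_kernel (\<lambda>x. f x - g x)" "mass (\<lambda>x. f x - g x) = mass f - mass g"
    "moment2 (\<lambda>x. f x - g x) = moment2 f - moment2 g"
proof -
  show "moment_kernel (\<lambda>x. f x - g x)"
    using assms summable_on_add[of "\<lambda>x. (1 + eucl_sq x) * f x" UNIV "\<lambda>x. - ((1 + eucl_sq x) * g x)"]
    by (auto simp: moment_kernel_def right_diff_distrib summable_on_uminus)
  show "mass (\<lambda>x. f x - g x) = mass f - mass g"
    unfolding mass_def by (intro infsumI has_sum_diff has_sum_infsum moment_kernel_summable_0 assms)
  show "moment2 (\<lambda>x. f x - g x) = moment2 f - moment2 g"
    unfolding moment2_def right_diff_distrib by (intro infsumI has_sum_diff has_sum_infsum moment_kernel_summable_2 assms)
qed

text \<open>Fubini's theorem after the substitution \<open>x = y + z\<close>. Absolute summability follows from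
\<open>1 + eucl_sq (y + z) \<le> 2 * (1 + eucl_sq y) * (1 + eucl_sq z)\<close>.\<close>

lemma moment_kernel_conv_sum:
  fixes f g :: "int ^ 'd \<Rightarrow> real"
  assumes f: "moment_kernel f" and g: "moment_kernel g"
    and u: "\<And>x. \<bar>u x\<bar> \<le> 1 + eucl_sq x"
  shows "(\<lambda>(y, z). u (y + z) * (f y * g z)) summable_on UNIV \<times> UNIV"
    and "(\<lambda>x. u x * conv f g x) summable_on UNIV"
    and "(\<Sum>\<^sub>\<infinity>x\<in>UNIV. u x * conv f g x) = (\<Sum>\<^sub>\<infinity>(y, z)\<in>UNIV \<times> UNIV. u (y + z) * (f y * g z))"
proof -
  let ?w = "\<lambda>x. 1 + eucl_sq x"
  have w: "0 < ?w x" for x by (smt (verit) eucl_sq_nonneg)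
  have "(\<lambda>(y, z). ?w y * f y * (?w z * g z)) summable_on UNIV \<times> UNIV"
    using f g by (intro has_sum_imp_summable[OF has_sum_product_real]) (auto simp: moment_kernel_def)
  then have "(\<lambda>p. 2 * norm (case p of (y, z) \<Rightarrow> ?w y * f y * (?w z * g z))) summable_on UNIV \<times> UNIV"
    by (intro summable_on_cmult_right iffD1[OF summable_on_iff_abs_summable_on_real])
  then have "(\<lambda>p. norm (case p of (y, z) \<Rightarrow> u (y + z) * (f y * g z))) summable_on UNIV \<times> UNIV"
  proof (rule Infinite_Sum.abs_summable_on_comparison_test')
    fix p :: "(int ^ 'd) \<times> (int ^ 'd)"
    obtain y z where p: "p = (y, z)" by (cases p)
    have "\<bar>u (y + z)\<bar> \<le> 1 + (2 * eucl_sq y + 2 * eucl_sq z)"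
      using u[of "y + z"] eucl_sq_add_le[of y z] by linarith
    also have "\<dots> \<le> 2 * (?w y * ?w z)"
      by (simp add: algebra_simps)
    finally have "\<bar>u (y + z)\<bar> * \<bar>f y * g z\<bar> \<le> 2 * (?w y * ?w z) * \<bar>f y * g z\<bar>"
      by (intro mult_right_mono) auto
    then show "norm (case p of (y, z) \<Rightarrow> u (y + z) * (f y * g z))
        \<le> 2 * norm (case p of (y, z) \<Rightarrow> ?w y * f y * (?w z * g z))"
      using w[of y] w[of z] by (simp add: p abs_mult mult_ac)
  qed
  then show 1: "(\<lambda>(y, z). u (y + z) * (f y * g z)) summable_on UNIV \<times> UNIV"
    using summable_on_iff_abs_summable_on_real by blast
  have bij: "bij_betw (\<lambda>(x, y). (y, x - y)) UNIV (UNIV :: ((int ^ 'd) \<times> (int ^ 'd)) set)"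
    by (rule bij_betw_byWitness[of _ "\<lambda>(y, z). (y + z, y)"]) auto
  have 2: "(\<lambda>(x, y). u x * (f y * g (x - y))) summable_on UNIV \<times> UNIV"
    using summable_on_reindex_bij_betw[OF bij, of "\<lambda>(y, z). u (y + z) * (f y * g z)"] 1
    by (simp add: case_prod_unfold)
  have c: "(\<Sum>\<^sub>\<infinity>y\<in>UNIV. u x * (f y * g (x - y))) = u x * conv f g x" for x
    unfolding conv_def by (rule infsum_cmult_right')
  show "(\<lambda>x. u x * conv f g x) summable_on UNIV"
    using summable_on_Sigma_banach[OF 2] by (simp add: c)
  show "(\<Sum>\<^sub>\<infinity>x\<in>UNIV. u x * conv f g x) = (\<Sum>\<^sub>\<infinity>(y, z)\<in>UNIV \<times> UNIV. u (y + z) * (f y * g z))"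
    using infsum_Sigma_banach[OF 2] infsum_reindex_bij_betw[OF bij, of "\<lambda>(y, z). u (y + z) * (f y * g z)"]
    by (simp add: c case_prod_unfold)
qed


lemma conv_minus:
  fixes f g :: "int ^ 'd \<Rightarrow> real"
  assumes "\<And>x. f (- x) = f x" "\<And>x. g (- x) = g x"
  shows "conv f g (- x) = conv f g x"
  unfolding conv_def
proof (rule infsum_reindex_bij_witness[of _ uminus uminus])
  fix y
  have "g (x - - y) = g (- (x - - y))" by (rule assms(2)[symmetric])
  also have "- (x - - y) = - x - y" by simp
  finally show "f (- y) * g (x - - y) = f y * g (- x - y)" using assms(1) by simp
qed auto

text \<open>Expand \<open>eucl_sq (y + z)\<close>: the cross terms are products of first moments, which are zero.\<close>

lemma moment_kernel_conv:
  fixes f g :: "int ^ 'd \<Rightarrow> real"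
  assumes f: "moment_kernel f" and g: "moment_kernel g"
  shows "moment_kernel (conv f g)" "mass (conv f g) = mass f * mass g"
    "moment2 (conv f g) = moment2 f * mass g + mass f * moment2 g"
proof -
  show "moment_kernel (conv f g)"
    using f g moment_kernel_conv_sum(2)[OF f g, of "\<lambda>x. 1 + eucl_sq x"]
    by (auto simp: moment_kernel_def conv_minus)
  note prod = has_sum_product_real[where A = UNIV and B = UNIV]
  note f0 = moment_kernel_summable_0[OF f] and g0 = moment_kernel_summable_0[OF g]
  note f1 = moment_kernel_summable_1[OF f] and g1 = moment_kernel_summable_1[OF g]
  note f2 = moment_kernel_summable_2[OF f] and g2 = moment_kernel_summable_2[OF g]
  show "mass (conv f g) = mass f * mass g"
    using moment_kernel_conv_sum(3)[OF f g, of "\<lambda>_. 1"] infsumI[OF prod[OF f0 g0]]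
    by (simp add: mass_def)
  let ?c = "\<lambda>i (x :: int ^ 'd). real_of_int (x $ i)"
  have "((\<lambda>p. (\<lambda>(y, z). (eucl_sq y * f y) * g z) p + (\<lambda>(y, z). f y * (eucl_sq z * g z)) p
      + 2 * (\<Sum>i\<in>UNIV. (\<lambda>(y, z). (?c i y * f y) * (?c i z * g z)) p)) has_sum
      moment2 f * mass g + mass f * moment2 g
      + 2 * (\<Sum>i\<in>(UNIV :: 'd set). (\<Sum>\<^sub>\<infinity>y\<in>UNIV. ?c i y * f y) * (\<Sum>\<^sub>\<infinity>z\<in>UNIV. ?c i z * g z))) (UNIV \<times> UNIV)"
    unfolding mass_def moment2_def
    by (intro has_sum_add has_sum_cmult_right has_sum_sum prod f0 g0 f1 g1 f2 g2) auto
  then have "((\<lambda>p. (\<lambda>(y, z). (eucl_sq y * f y) * g z) p + (\<lambda>(y, z). f y * (eucl_sq z * g z)) p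
      + 2 * (\<Sum>i\<in>UNIV. (\<lambda>(y, z). (?c i y * f y) * (?c i z * g z)) p)) has_sum
      moment2 f * mass g + mass f * moment2 g) (UNIV \<times> UNIV)"
    by (simp only: moment_kernel_first_moment[OF f] mult_zero_left mult_zero_right sum.neutral_const add_0_right)
  then have "((\<lambda>(y, z). eucl_sq (y + z) * (f y * g z)) has_sum
      moment2 f * mass g + mass f * moment2 g) (UNIV \<times> UNIV)"
    by (simp add: eucl_sq_add case_prod_unfold
        algebra_simps sum_distrib_left)
  then show "moment2 (conv f g) = moment2 f * mass g + mass f * moment2 g"
    using moment_kernel_conv_sum(3)[OF f g, of eucl_sq] by (simp add: moment2_def infsumI)
qed

lemma lattice_symmetric_minus:
  assumes "lattice_symmetric f" shows "f (- x) = f x"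
proof -
  have "f (\<chi> i. (-1) * x $ i) = f x"
    using assms unfolding lattice_symmetric_def by (elim conjE allE[of _ "\<lambda>_. -1"]) simp
  moreover have "(\<chi> i. (-1) * x $ i) = - x" by (simp add: vec_eq_iff)
  ultimately show ?thesis by simp
qed

text \<open>Susceptibility and second moment are both of this form, with \<open>a = 0, b = 1\<close> and with
\<open>a = 1, b = moment2 J\<close>, so that inequalities between functions need to be summed only once.\<close>

definition weighted :: "real \<Rightarrow> real \<Rightarrow> (int ^ 'd \<Rightarrow> real) \<Rightarrow> real" where
  "weighted a b f = (\<Sum>\<^sub>\<infinity>x\<in>UNIV. (a * eucl_sq x + b) * f x)"

lemma has_sum_weighted:
  assumes "moment_kernel f"
  shows "((\<lambda>x. (a * eucl_sq x + b) * f x) has_sum (a * moment2 f + b * mass f)) UNIV"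
proof -
  have "((\<lambda>x. a * (eucl_sq x * f x) + b * f x) has_sum (a * moment2 f + b * mass f)) UNIV"
    unfolding moment2_def mass_def using assms
    by (intro has_sum_add has_sum_cmult_right has_sum_infsum moment_kernel_summable_0 moment_kernel_summable_2)
  then show ?thesis by (simp add: algebra_simps)
qed

lemma weighted_eq: "moment_kernel f \<Longrightarrow> weighted a b f = a * moment2 f + b * mass f"
  unfolding weighted_def by (intro infsumI has_sum_weighted)

lemma weighted_summable: "moment_kernel f \<Longrightarrow> (\<lambda>x. (a * eucl_sq x + b) * f x) summable_on UNIV"
  using has_sum_weighted has_sum_imp_summable by blast

lemma weighted_mono:
  assumes "moment_kernel f" "moment_kernel g" "0 \<le> a" "0 \<le> b" "\<And>x. f x \<le> g x"
  shows "weighted a b f \<le> weighted a b g"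
  unfolding weighted_def using assms
  by (intro infsum_mono weighted_summable mult_left_mono) auto

section \<open>Exponential decay makes second moments finite\<close>

lemma summable_exp_int:
  assumes "0 < b"
  shows "(\<lambda>k::int. exp (- b * real_of_int \<bar>k\<bar>)) summable_on UNIV"
proof -
  have "summable (\<lambda>n. exp (- b) ^ n)"
    by (rule summable_geometric) (use assms in simp)
  then have geo: "(\<lambda>n. exp (- b) ^ n) summable_on UNIV"
    by (simp add: norm_summable_imp_summable_on)
  have pow: "exp (- b) ^ n = exp (- b * real n)" for n
    by (simp add: exp_of_nat_mult[symmetric] mult.commute)
  have "bij_betw int UNIV {0..}"
    by (rule bij_betw_byWitness[of _ nat]) auto
  from summable_on_reindex_bij_betw[OF this, of "\<lambda>k::int. exp (- b * real_of_int \<bar>k\<bar>)"]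
  have 1: "(\<lambda>k::int. exp (- b * real_of_int \<bar>k\<bar>)) summable_on {0..}"
    using geo by (simp add: pow)
  have "bij_betw (\<lambda>n. - int n - 1) UNIV {..<0}"
    by (rule bij_betw_byWitness[of _ "\<lambda>k. nat (- k - 1)"]) auto
  from summable_on_reindex_bij_betw[OF this, of "\<lambda>k::int. exp (- b * real_of_int \<bar>k\<bar>)"]
  have "(\<lambda>k::int. exp (- b * real_of_int \<bar>k\<bar>)) summable_on {..<0}
      \<longleftrightarrow> (\<lambda>n. exp (- b) ^ n * exp (- b)) summable_on UNIV"
    by (simp add: pow exp_add[symmetric] algebra_simps)
  then have 2: "(\<lambda>k::int. exp (- b * real_of_int \<bar>k\<bar>)) summable_on {..<0}"
    using summable_on_cmult_left[OF geo] by simp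
  have "{0..} \<union> {..<0::int} = UNIV" "{0..} \<inter> {..<0::int} = {}" by auto
  with summable_on_Un_disjoint[OF 1 2] show ?thesis by simp
qed

text \<open>A finite set of lattice points lies in a box, over which the sum of products factorises.\<close>

lemma summable_prod_vec:
  fixes h :: "int \<Rightarrow> real"
  assumes nonneg: "\<And>k. 0 \<le> h k" and h: "h summable_on UNIV"
  shows "(\<lambda>x :: int ^ 'd. \<Prod>i\<in>UNIV. h (x $ i)) summable_on UNIV"
proof (rule nonneg_bdd_above_summable_on)
  show "bdd_above (sum (\<lambda>x :: int ^ 'd. \<Prod>i\<in>UNIV. h (x $ i)) ` {F. F \<subseteq> UNIV \<and> finite F})"
  proof (rule bdd_aboveI2)
    fix F :: "(int ^ 'd) set" assume "F \<in> {F. F \<subseteq> UNIV \<and> finite F}"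
    then have F: "finite F" by simp
    define B where "B = (\<Union>i\<in>UNIV. (\<lambda>x. x $ i) ` F)"
    have B: "finite B" using F by (simp add: B_def)
    have inj: "inj_on vec_nth F" by (auto intro: inj_onI simp: vec_eq_iff)
    have "(\<Sum>x\<in>F. \<Prod>i\<in>UNIV. h (x $ i)) = (\<Sum>y\<in>vec_nth ` F. \<Prod>i\<in>UNIV. h (y i))"
      using inj by (simp add: sum.reindex)
    also have "\<dots> \<le> (\<Sum>y\<in>PiE (UNIV :: 'd set) (\<lambda>_. B). \<Prod>i\<in>UNIV. h (y i))"
    proof (rule sum_mono2)
      show "finite ((UNIV :: 'd set) \<rightarrow>\<^sub>E B)" using B by (intro finite_PiE) auto
      show "vec_nth ` F \<subseteq> UNIV \<rightarrow>\<^sub>E B" by (auto simp: B_def)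
    qed (auto intro: prod_nonneg nonneg)
    also have "\<dots> = (\<Prod>i\<in>(UNIV :: 'd set). \<Sum>k\<in>B. h k)"
      using B by (subst prod_sum_PiE) auto
    also have "\<dots> \<le> (\<Prod>i\<in>(UNIV :: 'd set). infsum h UNIV)"
      using B by (intro prod_mono conjI sum_nonneg finite_sum_le_infsum h nonneg) auto
    finally show "(\<Sum>x\<in>F. \<Prod>i\<in>UNIV. h (x $ i)) \<le> (\<Prod>i\<in>(UNIV :: 'd set). infsum h UNIV)" .
  qed
qed (auto intro: prod_nonneg nonneg)

lemma abs_coord_le_sup_abs: "\<bar>real_of_int (x $ i)\<bar> \<le> sup_abs x"
proof -
  have "\<bar>x $ i\<bar> \<le> Max (range (\<lambda>i. \<bar>x $ i\<bar>))" by (rule Max_ge) auto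
  then have "real_of_int \<bar>x $ i\<bar> \<le> sup_abs x"
    unfolding sup_abs_def by (simp only: of_int_le_iff)
  then show ?thesis by simp
qed

lemma sup_abs_nonneg: "0 \<le> sup_abs x"
  using abs_coord_le_sup_abs[of x undefined] by linarith

text \<open>Half of the exponential absorbs the polynomial factor; the other half is at most a product of
one-dimensional exponentials, because the maximum norm is at least the average of the coordinates.\<close>

lemma summable_eucl_sq_exp:
  assumes "0 < a"
  shows "(\<lambda>x :: int ^ 'd. (1 + eucl_sq x) * exp (- a * sup_abs x)) summable_on UNIV"
proof -
  let ?d = "real CARD('d)"
  let ?C = "1 + 8 * ?d / a\<^sup>2"
  let ?b = "a / (2 * ?d)"
  have d: "0 < ?d" by simp
  have "(\<lambda>x :: int ^ 'd. \<Prod>i\<in>UNIV. exp (- ?b * real_of_int \<bar>x $ i\<bar>)) summable_on UNIV"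
    by (rule summable_prod_vec[OF _ summable_exp_int]) (use assms d in auto)
  then have "(\<lambda>x :: int ^ 'd. ?C * (\<Prod>i\<in>UNIV. exp (- ?b * real_of_int \<bar>x $ i\<bar>))) summable_on UNIV"
    by (rule summable_on_cmult_right)
  then show ?thesis
  proof (rule summable_on_comparison_test)
    fix x :: "int ^ 'd"
    define s where "s = sup_abs x"
    have s: "0 \<le> s" by (simp add: s_def sup_abs_nonneg)
    have "eucl_sq x \<le> (\<Sum>i\<in>(UNIV :: 'd set). s\<^sup>2)"
      unfolding eucl_sq_def s_def
      by (intro sum_mono) (metis abs_coord_le_sup_abs power2_abs power_mono abs_ge_zero)
    then have 1: "eucl_sq x \<le> ?d * s\<^sup>2" by simp
    \<comment> \<open>The quadratic Taylor term of the exponential dominates \<open>s\<^sup>2\<close>.\<close>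
    have E: "1 + a / 2 * s + (a / 2 * s)\<^sup>2 / 2 \<le> exp (a / 2 * s)"
      using assms s by (intro exp_lower_Taylor_quadratic) auto
    have as: "0 \<le> a / 2 * s" using assms s by auto
    have "s\<^sup>2 = 8 / a\<^sup>2 * ((a / 2 * s)\<^sup>2 / 2)" using assms by (simp add: power_mult_distrib power_divide)
    also have "\<dots> \<le> 8 / a\<^sup>2 * exp (a / 2 * s)"
      using E as by (intro mult_left_mono) auto
    finally have "?d * s\<^sup>2 \<le> ?d * (8 / a\<^sup>2 * exp (a / 2 * s))"
      by (intro mult_left_mono) auto
    moreover have "1 \<le> exp (a / 2 * s)" using as by simp
    ultimately have "1 + eucl_sq x \<le> exp (a / 2 * s) + ?d * (8 / a\<^sup>2 * exp (a / 2 * s))"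
      using 1 by linarith
    also have "\<dots> = ?C * exp (a / 2 * s)" by (simp add: algebra_simps)
    finally have "1 + eucl_sq x \<le> ?C * exp (a / 2 * s)" .
    then have "(1 + eucl_sq x) * exp (- a * s) \<le> ?C * exp (a / 2 * s) * exp (- a * s)"
      by (intro mult_right_mono) auto
    also have "\<dots> = ?C * exp (- (a / 2 * s))"
      by (simp add: mult_exp_exp)
    also have "\<dots> \<le> ?C * (\<Prod>i\<in>UNIV. exp (- ?b * real_of_int \<bar>x $ i\<bar>))"
    proof (rule mult_left_mono)
      have "?b * (\<Sum>i\<in>UNIV. real_of_int \<bar>x $ i\<bar>) \<le> ?b * (\<Sum>i\<in>(UNIV :: 'd set). s)"
        using assms d unfolding s_def
        by (intro mult_left_mono sum_mono) (auto simp: abs_coord_le_sup_abs)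
      then have "- (a / 2 * s) \<le> (\<Sum>i\<in>UNIV. - ?b * real_of_int \<bar>x $ i\<bar>)"
        unfolding sum_distrib_left[symmetric] using d by simp
      then show "exp (- (a / 2 * s)) \<le> (\<Prod>i\<in>UNIV. exp (- ?b * real_of_int \<bar>x $ i\<bar>))"
        unfolding exp_sum[OF finite, symmetric] by simp
    qed simp
    finally show "(1 + eucl_sq x) * exp (- a * sup_abs x)
        \<le> ?C * (\<Prod>i\<in>UNIV. exp (- ?b * real_of_int \<bar>x $ i\<bar>))"
      by (simp add: s_def)
  qed simp
qed

lemma exp_decay_finite: "exp_decay f \<Longrightarrow> f x < \<infinity>"
  unfolding exp_decay_def by (metis ennreal_less_top infinity_ennreal_def order_le_less_trans)

lemma exp_decay_moment_kernel:
  assumes "exp_decay f" "\<And>x. f (- x) = f x"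
  shows "moment_kernel (\<lambda>x. enn2real (f x))"
proof -
  obtain K a where K: "0 < K" "0 < a" "\<And>x. f x \<le> ennreal (K * exp (- a * sup_abs x))"
    using assms(1) by (auto simp: exp_decay_def)
  have "(\<lambda>x. K * ((1 + eucl_sq x) * exp (- a * sup_abs x))) summable_on UNIV"
    by (intro summable_on_cmult_right summable_eucl_sq_exp K)
  then have "(\<lambda>x. (1 + eucl_sq x) * enn2real (f x)) summable_on UNIV"
  proof (rule summable_on_comparison_test)
    fix x
    have "enn2real (f x) \<le> K * exp (- a * sup_abs x)"
      using K(1) by (intro enn2real_leI K) auto
    then have "(1 + eucl_sq x) * enn2real (f x) \<le> (1 + eucl_sq x) * (K * exp (- a * sup_abs x))"
      by (intro mult_left_mono) auto
    then show "(1 + eucl_sq x) * enn2real (f x) \<le> K * ((1 + eucl_sq x) * exp (- a * sup_abs x))"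
      by (simp add: mult_ac)
  qed auto
  then show ?thesis using assms(2) by (simp add: moment_kernel_def)
qed

section \<open>Extended nonnegative sums and convolutions as real ones\<close>

lemma infsum_ennreal:
  fixes f :: "'a \<Rightarrow> real"
  assumes "f summable_on A" "\<And>x. x \<in> A \<Longrightarrow> 0 \<le> f x"
  shows "(\<Sum>\<^sub>\<infinity>x\<in>A. ennreal (f x)) = ennreal (\<Sum>\<^sub>\<infinity>x\<in>A. f x)"
proof (rule infsumI)
  have "(sum f \<longlongrightarrow> infsum f A) (finite_subsets_at_top A)"
    using assms(1) has_sum_infsum has_sum_def by blast
  then have "((\<lambda>F. ennreal (sum f F)) \<longlongrightarrow> ennreal (infsum f A)) (finite_subsets_at_top A)"
    by (rule tendsto_ennrealI)
  moreover have "\<forall>\<^sub>F F in finite_subsets_at_top A. ennreal (sum f F) = (\<Sum>x\<in>F. ennreal (f x))"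
    by (rule eventually_finite_subsets_at_top_weakI) (subst sum_ennreal, use assms(2) in auto)
  ultimately show "((\<lambda>x. ennreal (f x)) has_sum ennreal (infsum f A)) A"
    unfolding has_sum_def by (rule Lim_transform_eventually)
qed

lemma l1_ennreal:
  assumes "moment_kernel f" "\<And>x. 0 \<le> f x"
  shows "l1 (\<lambda>x. ennreal (f x)) = ennreal (mass f)"
  unfolding l1_def mass_def using assms by (intro infsum_ennreal moment_kernel_summable_0) auto

lemma second_moment_ennreal:
  assumes "moment_kernel f" "\<And>x. 0 \<le> f x"
  shows "second_moment (\<lambda>x. ennreal (f x)) = ennreal (moment2 f)"
proof -
  have "second_moment (\<lambda>x. ennreal (f x)) = (\<Sum>\<^sub>\<infinity>x\<in>UNIV. ennreal (eucl_sq x * f x))"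
    by (simp add: second_moment_def l1_def ennreal_mult assms(2))
  then show ?thesis
    unfolding moment2_def using assms by (subst (asm) infsum_ennreal) (auto intro: moment_kernel_summable_2)
qed

lemma mass_nonneg: "(\<And>x. 0 \<le> f x) \<Longrightarrow> 0 \<le> mass f"
  by (simp add: mass_def infsum_nonneg)

lemma moment2_nonneg: "(\<And>x. 0 \<le> f x) \<Longrightarrow> 0 \<le> moment2 f"
  by (simp add: moment2_def infsum_nonneg)

lemma conv_nonneg: "(\<And>x. 0 \<le> f x) \<Longrightarrow> (\<And>x. 0 \<le> g x) \<Longrightarrow> 0 \<le> (conv f g x :: real)"
  by (simp add: conv_def infsum_nonneg)

lemma conv_ennreal:
  assumes f: "moment_kernel f" "\<And>x. 0 \<le> f x" and g: "moment_kernel g" "\<And>x. 0 \<le> g x"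
  shows "conv (\<lambda>x. ennreal (f x)) (\<lambda>x. ennreal (g x)) = (\<lambda>x. ennreal (conv f g x))"
proof
  fix x
  have "(\<lambda>y. f y * g (x - y)) summable_on UNIV"
  proof (rule summable_on_comparison_test)
    show "(\<lambda>y. f y * mass g) summable_on UNIV"
      by (intro summable_on_cmult_left moment_kernel_summable_0 f)
    fix y
    have "g (x - y) \<le> mass g"
      using finite_sum_le_infsum[OF moment_kernel_summable_0[OF g(1)], of "{x - y}"] g(2)
      by (simp add: mass_def)
    then show "f y * g (x - y) \<le> f y * mass g" using f(2) by (intro mult_left_mono) auto
  qed (use f g in auto)
  then show "conv (\<lambda>x. ennreal (f x)) (\<lambda>x. ennreal (g x)) x = ennreal (conv f g x)"
    unfolding conv_def by (subst infsum_ennreal[symmetric]) (auto simp: f g ennreal_mult)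
qed

section \<open>Critical behaviour of a spread-out model\<close>

text \<open>The error supremum enters through a real upper bound \<open>e\<close>, so that the calculus stays within
the reals.\<close>

locale spread_out_model =
  fixes c0 :: real and J :: "int ^ 'd \<Rightarrow> real" and \<beta>c :: ennreal
    and G :: "ennreal \<Rightarrow> int ^ 'd \<Rightarrow> ennreal" and H :: "ennreal \<Rightarrow> int ^ 'd \<Rightarrow> real" and e :: real
  assumes c0: "0 < c0" and J: "admissible c0 J" and G: "class_G \<beta>c G" and GH: "assumption1 J \<beta>c G H"
    and err: "err_E J \<beta>c G H \<beta>c \<le> ennreal e" and e: "0 \<le> e" "e < 1 / 2"
begin

definition g :: "real \<Rightarrow> int ^ 'd \<Rightarrow> real" where
  "g t x = enn2real (G (ennreal t) x)"

definition h :: "real \<Rightarrow> int ^ 'd \<Rightarrow> real" where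
  "h t = H (ennreal t)"

text \<open>This is the lower bound that the assumption gives for the derivative of \<open>g\<close> in \<open>t\<close>.\<close>

definition growth_rate :: "real \<Rightarrow> int ^ 'd \<Rightarrow> real" where
  "growth_rate t = conv (conv (g t) (\<lambda>y. J y - h t y)) (g t)"

abbreviation I :: "real set" where "I \<equiv> subcritical \<beta>c"

lemma I_D: "t \<in> I \<Longrightarrow> 0 \<le> t" "t \<in> I \<Longrightarrow> ennreal t < \<beta>c"
  by (auto simp: subcritical_def)

lemma I_downward: "t \<in> I \<Longrightarrow> 0 \<le> s \<Longrightarrow> s \<le> t \<Longrightarrow> s \<in> I"
  unfolding subcritical_def by (auto intro: le_less_trans[of "ennreal s" "ennreal t"] ennreal_leI)

lemma I_open_right:
  assumes "t \<in> I" obtains u where "t < u" "u \<in> I"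
proof -
  obtain z where z: "ennreal t < z" "z < \<beta>c" using dense[OF I_D(2)[OF assms]] by blast
  have "z < top" using z(2) by (meson less_le_trans top_greatest)
  then have "ennreal (enn2real z) = z" by simp
  moreover have "t < enn2real z"
    using z(1) I_D(1)[OF assms] \<open>ennreal (enn2real z) = z\<close>
    by (metis ennreal_less_iff)
  ultimately show ?thesis
    using z by (intro that[of "enn2real z"]) (auto simp: subcritical_def)
qed

lemma J_nonneg: "0 \<le> J x"
  using J by (simp add: admissible_def)

lemma moment_kernel_J: "moment_kernel J"
proof -
  have "{x. J x \<noteq> 0} = {x. J x > 0}" using J_nonneg by (auto simp: less_le)
  then have "finite {x. J x \<noteq> 0}" using J by (simp add: admissible_def)
  then have "finite {x \<in> UNIV. (1 + eucl_sq x) * J x \<noteq> 0}"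
    by (rule rev_finite_subset) auto
  then have "(\<lambda>x. (1 + eucl_sq x) * J x) summable_on UNIV"
    by (rule finite_nonzero_values_imp_summable_on)
  then show ?thesis
    using J by (auto simp: moment_kernel_def admissible_def intro: lattice_symmetric_minus)
qed

lemma mass_J: "mass J = 1"
  using J unfolding mass_def admissible_def by (intro infsumI) auto

lemma sigma_sq: "(sigma_of J)\<^sup>2 = moment2 J"
  using moment2_nonneg[OF J_nonneg] by (simp add: sigma_of_def moment2_def)

lemma moment2_J_pos: "0 < moment2 J"
proof -
  have "0 < c0 * kernel_range J" "c0 * kernel_range J \<le> sigma_of J"
    using J c0 by (auto simp: admissible_def)
  then have "0 < sigma_of J" by linarith
  then show ?thesis using sigma_sq by (metis zero_less_power)
qed

lemma G_eq: "t \<in> I \<Longrightarrow> G (ennreal t) = (\<lambda>x. ennreal (g t x))"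
  using G exp_decay_finite[of "G (ennreal t)"] by (auto simp: class_G_def g_def I_D ennreal_enn2real)

lemma g_nonneg: "0 \<le> g t x"
  by (simp add: g_def)

lemma moment_kernel_g: "t \<in> I \<Longrightarrow> moment_kernel (g t)"
  unfolding g_def using G I_D[of t]
  by (intro exp_decay_moment_kernel lattice_symmetric_minus) (auto simp: class_G_def)

lemma g_0: "g 0 = delta0"
  using G by (auto simp: g_def class_G_def delta0_def)

lemma g_mono:
  assumes "t \<in> I" "0 \<le> s" "s \<le> t" shows "g s x \<le> g t x"
proof -
  have s: "s \<in> I" using assms by (rule I_downward)
  have "mono_on {..<\<beta>c} (\<lambda>\<beta>. G \<beta> x)" using G by (simp add: class_G_def)
  then have "G (ennreal s) x \<le> G (ennreal t) x"
    using assms s by (elim mono_onD) (auto simp: I_D ennreal_leI)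
  then show ?thesis by (simp add: G_eq assms s g_nonneg)
qed

lemma h_nonneg: "t \<in> I \<Longrightarrow> 0 \<le> h t x"
  using GH I_D[of t] by (simp add: assumption1_def h_def)

lemma moment_kernel_h:
  assumes "t \<in> I" shows "moment_kernel (h t)"
proof -
  have "exp_decay (\<lambda>x. ennreal (h t x))" "\<And>x. h t (- x) = h t x"
    using GH I_D[OF assms] by (simp_all add: assumption1_def h_def)
  from exp_decay_moment_kernel[OF this(1)] this(2) show ?thesis
    by (simp add: h_nonneg assms)
qed

lemma mass_g_0: "mass (g 0) = 1"
proof -
  have "(delta0 has_sum (1 :: real)) (UNIV :: (int ^ 'd) set)"
    by (rule has_sum_finite_neutralI[of "{0}"]) (auto simp: delta0_def)
  then show ?thesis by (simp add: g_0 mass_def infsumI)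
qed

lemma moment2_g_0: "moment2 (g 0) = 0"
proof -
  have "(\<lambda>x :: int ^ 'd. eucl_sq x * delta0 x) = (\<lambda>x. 0)" by (auto simp: delta0_def)
  then show ?thesis by (simp add: g_0 moment2_def)
qed

definition chi :: "real \<Rightarrow> real" where
  "chi t = weighted 0 1 (g t)"

text \<open>Because \<open>J\<close> has mass 1, this weighted sum of \<open>g t\<close> is the second moment of
\<open>conv J (g t)\<close>. Writing it in terms of \<open>g t\<close> lets both \<open>chi\<close> and \<open>M\<close> inherit
their differential inequalities from \<open>g\<close>.\<close>

definition M :: "real \<Rightarrow> real" where
  "M t = weighted 1 (moment2 J) (g t)"

lemma chi_eq: "t \<in> I \<Longrightarrow> chi t = mass (g t)"
  by (simp add: chi_def weighted_eq moment_kernel_g)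

lemma M_eq: "t \<in> I \<Longrightarrow> M t = moment2 (g t) + moment2 J * mass (g t)"
  by (simp add: M_def weighted_eq moment_kernel_g)

lemma weighted_g_mono:
  "t \<in> I \<Longrightarrow> 0 \<le> s \<Longrightarrow> s \<le> t \<Longrightarrow> 0 \<le> a \<Longrightarrow> 0 \<le> b \<Longrightarrow> weighted a b (g s) \<le> weighted a b (g t)"
  by (intro weighted_mono moment_kernel_g g_mono) (auto intro: I_downward)

lemma chi_ge_1: assumes "t \<in> I" shows "1 \<le> chi t"
proof -
  have "0 \<in> I" by (rule I_downward[OF assms order_refl I_D(1)[OF assms]])
  then have "chi 0 = 1" using chi_eq mass_g_0 by simp
  then show ?thesis
    using weighted_g_mono[of t 0 0 1] assms I_D(1) by (simp add: chi_def)
qed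

lemma M_pos: assumes "t \<in> I" shows "0 < M t"
proof -
  have "0 < moment2 J * mass (g t)"
    using moment2_J_pos chi_ge_1[OF assms] chi_eq[OF assms] by (intro mult_pos_pos) auto
  then show ?thesis using M_eq[OF assms] moment2_nonneg[of "g t"] g_nonneg by fastforce
qed

lemma g_upper:
  assumes t: "t \<in> I" "0 \<le> s" "s \<le> t"
  shows "g t x \<le> g s x + (t - s) * conv (conv (g s) J) (g t) x"
proof -
  have s: "s \<in> I" using t by (rule I_downward)
  have "G (ennreal t) x \<le> G (ennreal s) x
      + (ennreal t - ennreal s) * conv (conv (G (ennreal s)) (\<lambda>y. ennreal (J y))) (G (ennreal t)) x"
    using GH t I_D(2)[OF t(1)] by (simp add: assumption1_def ennreal_leI)
  also have "conv (conv (G (ennreal s)) (\<lambda>y. ennreal (J y))) (G (ennreal t)) x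
      = ennreal (conv (conv (g s) J) (g t) x)"
    using s t
    by (simp add: G_eq conv_ennreal moment_kernel_g g_nonneg moment_kernel_J J_nonneg
        moment_kernel_conv(1) conv_nonneg)
  finally have "ennreal (g t x) \<le> ennreal (g s x + (t - s) * conv (conv (g s) J) (g t) x)"
    using s t by (simp add: G_eq g_nonneg J_nonneg conv_nonneg ennreal_minus
        flip: ennreal_mult ennreal_plus)
  then show ?thesis
    using t by (subst (asm) ennreal_le_iff) (auto simp: g_nonneg J_nonneg conv_nonneg)
qed

lemma weighted_upper:
  assumes t: "t \<in> I" "0 \<le> s" "s \<le> t" and ab: "0 \<le> a" "0 \<le> b"
  shows "weighted a b (g t) \<le> weighted a b (g s) + (t - s) * weighted a b (conv (conv (g s) J) (g t))"
proof -
  have s: "s \<in> I" using t by (rule I_downward)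
  note mk = moment_kernel_g[OF s] moment_kernel_g[OF t(1)] moment_kernel_J
  have mkc: "moment_kernel (conv (conv (g s) J) (g t))"
    by (intro moment_kernel_conv(1) mk)
  have "((\<lambda>x. (a * eucl_sq x + b) * g s x
        + (t - s) * ((a * eucl_sq x + b) * conv (conv (g s) J) (g t) x)) has_sum
      weighted a b (g s) + (t - s) * weighted a b (conv (conv (g s) J) (g t))) UNIV"
    unfolding weighted_def
    by (intro has_sum_add has_sum_cmult_right has_sum_infsum weighted_summable mk mkc)
  moreover have "((\<lambda>x. (a * eucl_sq x + b) * g t x) has_sum weighted a b (g t)) UNIV"
    unfolding weighted_def by (intro has_sum_infsum weighted_summable mk)
  moreover have "(a * eucl_sq x + b) * g t x \<le> (a * eucl_sq x + b) * g s x
        + (t - s) * ((a * eucl_sq x + b) * conv (conv (g s) J) (g t) x)" for x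
    using mult_left_mono[OF g_upper[OF t, of x], of "a * eucl_sq x + b"] ab
    by (simp add: algebra_simps)
  ultimately show ?thesis by (blast intro: has_sum_mono)
qed

text \<open>Masses multiply under convolution, and \<open>J\<close> has mass 1.\<close>

lemma chi_upper:
  assumes t: "t \<in> I" "0 \<le> s" "s \<le> t"
  shows "chi t \<le> chi s + (t - s) * (chi s * chi t)"
proof -
  have s: "s \<in> I" using t by (rule I_downward)
  note mk = moment_kernel_g[OF s] moment_kernel_g[OF t(1)] moment_kernel_J
  show ?thesis
    using weighted_upper[OF t, of 0 1]
    by (simp add: chi_eq[symmetric] s t chi_def[symmetric] weighted_eq moment_kernel_conv mk mass_J)
qed

lemma M_upper:
  assumes t: "t \<in> I" "0 \<le> s" "s \<le> t"
  shows "M t \<le> M s + (t - s) * (M s * chi t + chi s * M t)"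
proof -
  have s: "s \<in> I" using t by (rule I_downward)
  note mk = moment_kernel_g[OF s] moment_kernel_g[OF t(1)] moment_kernel_J
  have "weighted 1 (moment2 J) (conv (conv (g s) J) (g t)) = M s * chi t + chi s * M t"
    by (simp add: M_eq chi_eq s t weighted_eq moment_kernel_conv mk mass_J algebra_simps)
  then show ?thesis
    using weighted_upper[OF t, of 1 "moment2 J"] moment2_J_pos by (simp add: M_def)
qed

lemma right_growth_g:
  assumes t: "t \<in> I"
  shows "right_growth (\<lambda>s. g s x) t (growth_rate t x)"
proof -
  obtain u where u: "t < u" "u \<in> I" using t by (rule I_open_right)
  obtain D where D: "((\<lambda>s. g s x) has_real_derivative D) (at t within I)" "growth_rate t x \<le> D"
  proof -
    have "\<forall>t\<in>I. \<forall>x. \<exists>D. ((\<lambda>s. enn2real (G (ennreal s) x)) has_real_derivative D) (at t within I) \<and>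
        D \<ge> conv (conv (\<lambda>y. enn2real (G (ennreal t) y)) (\<lambda>y. J y - H (ennreal t) y))
                 (\<lambda>y. enn2real (G (ennreal t) y)) x"
      using GH unfolding assumption1_def by (elim conjE)
    from this[rule_format, OF t, of x, folded g_def h_def] show ?thesis
      by (auto simp: growth_rate_def intro: that)
  qed
  have "{t<..<u} \<subseteq> I" using u I_D(1)[OF t] I_downward[of u] by auto
  with D(1) have "((\<lambda>s. g s x) has_real_derivative D) (at t within {t<..<u})"
    by (rule DERIV_subset)
  moreover have "at t within {t<..<u} = at_right t"
    using u(1) by (intro at_within_nhd[of t "{..<u}"]) auto
  ultimately have "((\<lambda>s. g s x) has_real_derivative D) (at_right t)" by simp
  then show ?thesis
    using D(2) right_growth_has_derivative right_growth_mono by blast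
qed

lemma moment_kernel_growth_rate:
  assumes "t \<in> I"
  shows "moment_kernel (growth_rate t)"
    and "mass (growth_rate t) = (1 - mass (h t)) * (chi t)\<^sup>2"
    and "moment2 (growth_rate t) = 2 * (1 - mass (h t)) * moment2 (g t) * chi t
      + (moment2 J - moment2 (h t)) * (chi t)\<^sup>2"
  using moment_kernel_g[OF assms] moment_kernel_h[OF assms] moment_kernel_J
  unfolding growth_rate_def
  by (simp_all add: moment_kernel_conv moment_kernel_diff mass_J chi_eq assms power2_eq_square algebra_simps)

lemma right_growth_weighted:
  assumes t: "t \<in> I" and ab: "0 \<le> a" "0 \<le> b"
  shows "right_growth (\<lambda>s. weighted a b (g s)) t (weighted a b (growth_rate t))"
proof -
  obtain u where u: "t < u" "u \<in> I" using t by (rule I_open_right)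
  have I: "s \<in> I" if "t \<le> s" "s < u" for s
    using that u I_D(1)[OF t] I_downward[of u s] by auto
  show ?thesis
    unfolding weighted_def
    using ab t I I_D(1)[OF t]
    by (intro right_growth_infsum[OF u(1)] weighted_summable moment_kernel_g
        moment_kernel_growth_rate(1) g_mono right_growth_g) auto
qed

lemma susc_eq: "t \<in> I \<Longrightarrow> susc G (ennreal t) = ennreal (chi t)"
  by (simp add: susc_def G_eq l1_ennreal moment_kernel_g g_nonneg chi_eq)

lemma xi_sq_eq:
  assumes t: "t \<in> I"
  shows "xi_sq J G (ennreal t) = ennreal (M t / chi t)"
proof -
  note mk = moment_kernel_J moment_kernel_g[OF t]
  have "J_conv_G J G (ennreal t) = (\<lambda>x. ennreal (conv J (g t) x))"
    unfolding J_conv_G_def G_eq[OF t] by (intro conv_ennreal mk J_nonneg g_nonneg)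
  then have "second_moment (J_conv_G J G (ennreal t)) = ennreal (moment2 (conv J (g t)))"
    by (simp add: second_moment_ennreal moment_kernel_conv(1) mk conv_nonneg J_nonneg g_nonneg)
  also have "moment2 (conv J (g t)) = M t"
    by (simp add: moment_kernel_conv mk M_eq t mass_J algebra_simps)
  finally show ?thesis
    using chi_ge_1[OF t] M_pos[OF t] 
    by (simp add: xi_sq_def susc_eq[OF t] divide_ennreal)
qed

text \<open>As \<open>xi_sq\<close> equals \<open>M / chi\<close>, the error term bounds the mass of \<open>h\<close> and its second moment
simultaneously.\<close>

lemma error_bound:
  assumes t: "t \<in> I"
  shows "mass (h t) \<le> e" "moment2 (h t) * chi t \<le> (e - mass (h t)) * M t"
proof -
  note mk = moment_kernel_h[OF t]
  have pos: "0 < M t" "0 < chi t" using M_pos[OF t] chi_ge_1[OF t] by auto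
  have hpos: "0 \<le> mass (h t)" "0 \<le> moment2 (h t)"
    using h_nonneg[OF t] by (auto intro: mass_nonneg moment2_nonneg)
  have "l1 (\<lambda>x. ennreal (H (ennreal t) x))
      + second_moment (\<lambda>x. ennreal (H (ennreal t) x)) / xi_sq J G (ennreal t) \<le> err_E J \<beta>c G H \<beta>c"
    unfolding err_E_def using I_D(2)[OF t] by (intro SUP_upper) auto
  also have "\<dots> \<le> ennreal e" by (rule err)
  finally have "ennreal (mass (h t)) + ennreal (moment2 (h t)) / ennreal (M t / chi t) \<le> ennreal e"
    using h_nonneg[OF t]
    by (simp add: xi_sq_eq[OF t] l1_ennreal[OF mk] second_moment_ennreal[OF mk] flip: h_def)
  then have "ennreal (mass (h t) + moment2 (h t) / (M t / chi t)) \<le> ennreal e"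
    using pos hpos by (simp add: divide_ennreal)
  then have le: "mass (h t) + moment2 (h t) / (M t / chi t) \<le> e"
    using e by simp
  have "0 \<le> moment2 (h t) / (M t / chi t)" using pos hpos by auto
  with le show "mass (h t) \<le> e" by linarith
  have "moment2 (h t) / (M t / chi t) \<le> e - mass (h t)" using le by linarith
  then show "moment2 (h t) * chi t \<le> (e - mass (h t)) * M t"
    using pos by (simp add: pos_divide_le_eq)
qed

lemma chi_lower:
  assumes t: "t \<in> I"
  shows "right_growth chi t ((1 - e) * (chi t)\<^sup>2)"
proof (rule right_growth_mono)
  show "right_growth chi t (weighted 0 1 (growth_rate t))"
    unfolding chi_def[abs_def] using t by (rule right_growth_weighted) auto
  show "(1 - e) * (chi t)\<^sup>2 \<le> weighted 0 1 (growth_rate t)"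
    using error_bound(1)[OF t] moment_kernel_growth_rate[OF t]
    by (simp add: weighted_eq mult_right_mono)
qed

text \<open>With \<open>h0\<close> the mass of \<open>h t\<close>, the weighted sum of the growth rate is
\<open>2 (1 - h0) M chi\<close> plus a nonnegative term minus \<open>moment2 h * chi\<^sup>2\<close>. The error bound
estimates the last term by \<open>(e - h0) M chi\<close>, so the total loss relative to \<open>2 M chi\<close> is at most
\<open>(h0 + e) M chi\<close>, hence at most \<open>2 e M chi\<close>.\<close>

lemma M_lower:
  assumes t: "t \<in> I"
  shows "right_growth M t (2 * (1 - e) * (M t * chi t))"
proof (rule right_growth_mono)
  show "right_growth M t (weighted 1 (moment2 J) (growth_rate t))"
    unfolding M_def[abs_def] using t moment2_J_pos by (intro right_growth_weighted) auto
  define h0 where "h0 = mass (h t)"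
  have pos: "0 < M t" "0 < chi t" using M_pos[OF t] chi_ge_1[OF t] by auto
  have h0: "0 \<le> h0" "h0 \<le> e"
    unfolding h0_def using h_nonneg[OF t] error_bound(1)[OF t] by (auto intro: mass_nonneg)
  have "moment2 (h t) * chi t * chi t \<le> (e - h0) * M t * chi t"
    unfolding h0_def using error_bound(2)[OF t] pos by (intro mult_right_mono) auto
  moreover have "(e - h0) * (M t * chi t) \<ge> 0" "moment2 J * h0 * (chi t)\<^sup>2 \<ge> 0"
    using pos h0 moment2_J_pos by auto
  moreover have "weighted 1 (moment2 J) (growth_rate t)
      = 2 * (1 - h0) * (M t * chi t) + moment2 J * h0 * (chi t)\<^sup>2 - moment2 (h t) * chi t * chi t"
    by (simp add: weighted_eq moment_kernel_growth_rate[OF t] M_eq[OF t] chi_eq[OF t] h0_def power2_eq_square algebra_simps)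
  ultimately show "2 * (1 - e) * (M t * chi t) \<le> weighted 1 (moment2 J) (growth_rate t)"
    by (simp add: algebra_simps)
qed

lemma critical_growth:
  assumes u: "0 < u" "ennreal u \<le> \<beta>c"
  shows "critical_growth chi M u e"
proof
  have I: "t \<in> I" if "0 \<le> t" "t < u" for t
  proof -
    have "ennreal t < ennreal u" using that by (simp add: ennreal_less_iff)
    then show ?thesis using that u by (auto simp: subcritical_def)
  qed
  have 0: "0 \<in> I" using I u by auto
  show "chi 0 = 1" "0 < M 0" using 0 M_pos by (auto simp: chi_eq mass_g_0)
  show "chi s \<le> chi t" "M s \<le> M t" if "0 \<le> s" "s \<le> t" "t < u" for s t
    unfolding chi_def M_def using that I moment2_J_pos by (auto intro!: weighted_g_mono)
  show "chi t \<le> chi s + (t - s) * (chi s * chi t)"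
    "M t \<le> M s + (t - s) * (M s * chi t + chi s * M t)" if "0 \<le> s" "s \<le> t" "t < u" for s t
    using that I by (auto intro!: chi_upper M_upper)
  show "right_growth chi t ((1 - e) * (chi t)\<^sup>2)"
    "right_growth M t (2 * (1 - e) * (M t * chi t))" if "0 \<le> t" "t < u" for t
    using I[OF that] by (rule chi_lower M_lower)+
qed (use u e in auto)

lemma I_iff: "ennreal b = \<beta>c \<Longrightarrow> t \<in> I \<longleftrightarrow> 0 \<le> t \<and> t < b"
  by (auto simp: subcritical_def ennreal_less_iff)

lemma \<beta>c_pos: assumes "susc G \<beta>c = \<infinity>" shows "0 < \<beta>c"
proof (rule ccontr)
  assume "\<not> 0 < \<beta>c"
  then have "G \<beta>c = (\<lambda>x. ennreal (delta0 x))" using G by (auto simp: class_G_def)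
  moreover have "(delta0 has_sum (1 :: real)) (UNIV :: (int ^ 'd) set)"
    by (rule has_sum_finite_neutralI[of "{0}"]) (auto simp: delta0_def)
  then have "(\<Sum>\<^sub>\<infinity>x\<in>(UNIV :: (int ^ 'd) set). ennreal (delta0 x)) = ennreal 1"
    by (subst infsum_ennreal) (auto simp: delta0_def dest: has_sum_imp_summable infsumI)
  ultimately show False using assms by (simp add: susc_def l1_def)
qed

text \<open>Otherwise the growth inequalities would hold on an interval longer than \<open>1 / (1 - e)\<close>. In
particular \<open>\<beta>c\<close> is finite, so that the left-continuity of the family at \<open>\<beta>c\<close> becomes
available.\<close>

lemma \<beta>c_le: "\<beta>c \<le> ennreal (1 / (1 - e))"
proof (rule ccontr)
  assume "\<not> \<beta>c \<le> ennreal (1 / (1 - e))"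
  then obtain z where z: "ennreal (1 / (1 - e)) < z" "z < \<beta>c"
    using dense[of "ennreal (1 / (1 - e))" \<beta>c] by (auto simp: not_le)
  have "z < top" using z(2) by (meson less_le_trans top_greatest)
  then have z': "ennreal (enn2real z) = z" by simp
  with z(1) have "ennreal (1 / (1 - e)) < ennreal (enn2real z)" by simp
  then have less: "1 / (1 - e) < enn2real z"
    using e by (subst (asm) ennreal_less_iff) auto
  moreover have "0 < 1 / (1 - e)" using e by simp
  ultimately have "0 < enn2real z" by linarith
  then have "critical_growth chi M (enn2real z) e"
    using z z' by (intro critical_growth) auto
  then have "enn2real z \<le> 1 / (1 - e)" by (rule critical_growth.b_le)
  with less show False by simp
qed

text \<open>By left-continuity at \<open>\<beta>c\<close>, a bound on \<open>chi\<close> would pass to every finite partial sum of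
\<open>G \<beta>c\<close> and thus to the susceptibility there.\<close>

lemma chi_unbounded:
  assumes b: "ennreal b = \<beta>c" "0 < b" and inf: "susc G \<beta>c = \<infinity>"
  shows "\<exists>t. 0 \<le> t \<and> t < b \<and> B < chi t"
proof (rule ccontr)
  assume "\<not> ?thesis"
  then have le: "chi t \<le> B" if "t \<in> I" for t
    using that b by (auto simp: I_iff[OF b(1)] not_less)
  have "\<beta>c < \<infinity>" using b by auto
  then have lim: "((\<lambda>\<beta>. G \<beta> x) \<longlongrightarrow> G \<beta>c x) (at_left \<beta>c)" for x
    using G by (auto simp: class_G_def)
  have "sum (G \<beta>c) F \<le> ennreal B" if F: "finite F" for F
  proof (rule tendsto_upperbound)
    show "((\<lambda>\<beta>. \<Sum>x\<in>F. G \<beta> x) \<longlongrightarrow> sum (G \<beta>c) F) (at_left \<beta>c)"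
      by (intro tendsto_sum lim)
    show "\<forall>\<^sub>F \<beta> in at_left \<beta>c. (\<Sum>x\<in>F. G \<beta> x) \<le> ennreal B"
      unfolding eventually_at_filter
    proof (intro always_eventually allI impI)
      fix \<beta> assume "\<beta> \<noteq> \<beta>c" "\<beta> \<in> {..<\<beta>c}"
      then have "\<beta> < top" by (auto intro: less_le_trans)
      define t where "t = enn2real \<beta>"
      have \<beta>: "\<beta> = ennreal t" using \<open>\<beta> < top\<close> by (simp add: t_def)
      have "ennreal t < \<beta>c" using \<open>\<beta> \<in> {..<\<beta>c}\<close> unfolding \<beta>[symmetric] by simp
      moreover have "0 \<le> t" by (simp add: t_def)
      ultimately have t: "t \<in> I" by (simp add: subcritical_def)
      have "(\<Sum>x\<in>F. G \<beta> x) = ennreal (\<Sum>x\<in>F. g t x)"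
        unfolding \<beta> G_eq[OF t] by (rule sum_ennreal) (rule g_nonneg)
      also have "\<dots> \<le> ennreal (chi t)"
        unfolding chi_eq[OF t] mass_def
        by (intro ennreal_leI finite_sum_le_infsum moment_kernel_summable_0 moment_kernel_g t F)
          (auto simp: g_nonneg)
      also have "\<dots> \<le> ennreal B" by (intro ennreal_leI le t)
      finally show "(\<Sum>x\<in>F. G \<beta> x) \<le> ennreal B" .
    qed
    show "at_left \<beta>c \<noteq> bot"
    proof
      assume "at_left \<beta>c = bot"
      then have "\<forall>\<^sub>F \<beta> in at_left \<beta>c. False" by simp
      then obtain y where "y < \<beta>c" "\<And>z. y < z \<Longrightarrow> z < \<beta>c \<Longrightarrow> False"
        unfolding eventually_at_left[OF \<beta>c_pos[OF inf]] by blast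
      then show False using dense by blast
    qed
  qed
  then have "infsum (G \<beta>c) UNIV \<le> ennreal B"
    by (intro infsum_le_finite_sums nonneg_summable_on_complete) auto
  with inf show False by (auto simp: susc_def l1_def top_unique)
qed

lemma critical_behaviour:
  assumes inf: "susc G \<beta>c = \<infinity>"
  shows "1 \<le> \<beta>c"
    and "0 \<le> \<beta> \<Longrightarrow> ennreal \<beta> < \<beta>c \<Longrightarrow> r = enn2real \<beta>c - \<beta> \<Longrightarrow>
      ennreal (1 / r) \<le> susc G (ennreal \<beta>) \<and>
      susc G (ennreal \<beta>) \<le> ennreal (1 / (1 - e) * (1 / r)) \<and>
      ennreal ((1 / r) powr (1 - 2 * e)) \<le> xi_sq J G (ennreal \<beta>) / ennreal ((sigma_of J)\<^sup>2) \<and>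
      xi_sq J G (ennreal \<beta>) / ennreal ((sigma_of J)\<^sup>2)
        \<le> ennreal ((1 / ((1 - e) * r)) powr ((1 + e) / (1 - e)))"
proof -
  define b where "b = enn2real \<beta>c"
  have "\<beta>c < top" using \<beta>c_le by (rule le_less_trans) simp
  then have real_b: "ennreal b = \<beta>c" by (simp add: b_def)
  with \<beta>c_pos[OF inf] have "0 < b" by (metis ennreal_less_zero_iff)
  interpret cg: critical_growth chi M b e using \<open>0 < b\<close> real_b by (intro critical_growth) auto
  note blow_up = chi_unbounded[OF real_b \<open>0 < b\<close> inf]
  have "ennreal 1 \<le> ennreal b" using cg.b_ge_1[OF blow_up] by (rule ennreal_leI)
  then show "1 \<le> \<beta>c" by (simp add: real_b)
  assume t: "0 \<le> \<beta>" "ennreal \<beta> < \<beta>c" and r: "r = enn2real \<beta>c - \<beta>"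
  have I: "\<beta> \<in> I" using t by (simp add: subcritical_def)
  then have tb: "\<beta> < b" by (simp add: I_iff[OF real_b])
  have r': "r = b - \<beta>" by (simp add: r b_def)
  have "0 \<in> I" using \<open>0 < b\<close> by (simp add: I_iff[OF real_b])
  then have M0: "M 0 = moment2 J" by (simp add: M_eq mass_g_0 moment2_g_0)
  have xi: "xi_sq J G (ennreal \<beta>) / ennreal ((sigma_of J)\<^sup>2) = ennreal (M \<beta> / chi \<beta> / M 0)"
    unfolding xi_sq_eq[OF I] sigma_sq M0
    using M_pos[OF I] chi_ge_1[OF I] moment2_J_pos by (intro divide_ennreal) auto
  show "ennreal (1 / r) \<le> susc G (ennreal \<beta>) \<and>
      susc G (ennreal \<beta>) \<le> ennreal (1 / (1 - e) * (1 / r)) \<and>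
      ennreal ((1 / r) powr (1 - 2 * e)) \<le> xi_sq J G (ennreal \<beta>) / ennreal ((sigma_of J)\<^sup>2) \<and>
      xi_sq J G (ennreal \<beta>) / ennreal ((sigma_of J)\<^sup>2)
        \<le> ennreal ((1 / ((1 - e) * r)) powr ((1 + e) / (1 - e)))"
    unfolding xi susc_eq[OF I] r'
    using cg.chi_bounds[OF blow_up t(1) tb] cg.ratio_bounds[OF blow_up t(1) tb]
    by (auto intro!: ennreal_leI)
qed

end

theorem theorem1p7:
  fixes c0 \<epsilon> c C \<delta> :: real
    and J :: "int ^ 'd \<Rightarrow> real"
    and \<beta>c :: ennreal
    and G :: "ennreal \<Rightarrow> int ^ 'd \<Rightarrow> ennreal"
    and H :: "ennreal \<Rightarrow> int ^ 'd \<Rightarrow> real"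
  assumes "CARD('d) > 2"
    and "0 < c0" "c0 \<le> 1"
    and "0 < \<epsilon>" "\<epsilon> < 1"
    and "0 < c" "0 < C" "0 < \<delta>" "\<delta> \<le> 1 / 2"
    and "\<forall>(J' :: int ^ 'd \<Rightarrow> real) \<beta>c' G' H'.
           admissible c0 J' \<and> class_G \<beta>c' G' \<and> assumption1 J' \<beta>c' G' H' \<longrightarrow>
           decay_bound \<epsilon> c C \<delta> J' \<beta>c' G' H'"
    and "admissible c0 J"
    and "class_G \<beta>c G"
    and "assumption1 J \<beta>c G H"
    and "err_E J \<beta>c G H (beta_of J \<beta>c G H \<delta>) < ennreal \<delta>"
    and "err_E J \<beta>c G H \<beta>c < ennreal \<delta>"
    and "susc G \<beta>c = \<infinity>"
  shows "let e = enn2real (err_E J \<beta>c G H \<beta>c) in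
    1 \<le> \<beta>c \<and> \<beta>c \<le> ennreal (1 / (1 - e)) \<and>
    (\<forall>\<beta>::real. 0 \<le> \<beta> \<and> ennreal \<beta> < \<beta>c \<longrightarrow>
      (let r = enn2real \<beta>c - \<beta> in
        ennreal (1 / r) \<le> susc G (ennreal \<beta>) \<and>
        susc G (ennreal \<beta>) \<le> ennreal (1 / (1 - e) * (1 / r)) \<and>
        ennreal ((1 / r) powr (1 - 2 * e)) \<le> xi_sq J G (ennreal \<beta>) / ennreal ((sigma_of J)\<^sup>2) \<and>
        xi_sq J G (ennreal \<beta>) / ennreal ((sigma_of J)\<^sup>2)
          \<le> ennreal ((1 / ((1 - e) * r)) powr ((1 + e) / (1 - e)))))"
proof -
  define e where "e = enn2real (err_E J \<beta>c G H \<beta>c)"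
  have "err_E J \<beta>c G H \<beta>c < ennreal \<delta>" by fact
  then have err: "err_E J \<beta>c G H \<beta>c = ennreal e"
    unfolding e_def by (subst ennreal_enn2real) (auto intro: less_trans ennreal_less_top)
  have "0 \<le> e" by (simp add: e_def)
  have "ennreal e < ennreal \<delta>" using \<open>err_E J \<beta>c G H \<beta>c < ennreal \<delta>\<close> by (simp add: err)
  then have "e < 1 / 2"
    using \<open>0 \<le> e\<close> \<open>\<delta> \<le> 1 / 2\<close> by (simp add: ennreal_less_iff)
  interpret spread_out_model c0 J \<beta>c G H e
    by unfold_locales (fact | simp add: err)+
  show ?thesis
    unfolding Let_def e_def[symmetric]
    using \<beta>c_le critical_behaviour[OF \<open>susc G \<beta>c = \<infinity>\<close>] by blast
qed

end
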